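(* Let $n\ge1$, $1\le d\le m-1$ be integers. Let $\mathcal{M}_0$ be a (non-empty) compact $\mathcal{C}^3$-manifold, $u\colon\mathcal{M}_0\to\mathbb{R}^n$ an immersion and $p\colon\mathcal{M}_0\to\mathcal{G}_d(\mathbb{R}^m)$ a continuous map. Let $E=\mathbb{R}^n\times M(\mathbb{R}^m)$, endowed with the norm $\|\cdot\|_\gamma$ for some $\gamma>0$, let $\check u\colon\mathcal{M}_0\to E$, $\check u(x_0)=(u(x_0),P_{p(x_0)})$, and let $\check{\mathcal{M}}=\check u(\mathcal{M}_0)$. Suppose that $\check u$ is an embedding. Let $X\subset E$ be any (non-empty) subset such that $\mathrm{d}_H(X,\check{\mathcal{M}})\le\frac1{17}\mathrm{reach}(\check{\mathcal{M}})$, and let $\epsilon=\mathrm{d}_H(X,\check{\mathcal{M}})$. Then for every $t\in[4\epsilon,\mathrm{reach}(\check{\mathcal{M}})-3\epsilon)$ with $t<t^{\max}_\gamma(X)$, the composition $\mathcal{M}_0\xrightarrow{\check u}\check{\mathcal{M}}\hookrightarrow X^t$ induces an isomorphism $H^*(X^t)\to H^*(\mathcal{M}_0)$ which, for every $i\in\{1,\dots,d\}$, sends the $i$-th persistent Stiefel-Whitney class $w_i^t(X)$ at time $t$ of the Čech bundle filtration of $X$ to the $i$-th Stiefel-Whitney class of $(\mathcal{M}_0,p)$.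
   Context: $H^*$ is singular cohomology with $\mathbb{Z}/2$ coefficients. $M(\mathbb{R}^m)$ is the space of real $m\times m$ matrices with Frobenius norm $\|\cdot\|_F$; $E=\mathbb{R}^n\times M(\mathbb{R}^m)$ carries the Euclidean norm $\|(x,A)\|_\gamma^2=\|x\|^2+\gamma^2\|A\|_F^2$; the Hausdorff distance $\mathrm{d}_H$ and the reach are taken for this norm. For a $d$-plane $V\subset\mathbb{R}^m$, $P_V$ is the matrix of the orthogonal projection onto $V$; the Grassmannian $\mathcal{G}_d(\mathbb{R}^m)$ is identified via $V\mapsto P_V$ with the set of rank-$d$ orthogonal projection matrices in $M(\mathbb{R}^m)$. Its medial axis $\mathrm{med}(\mathcal{G}_d(\mathbb{R}^m))$ is the set of matrices having at least two distinct nearest points (for $\|\cdot\|_F$) in $\mathcal{G}_d(\mathbb{R}^m)$; outside it, $\mathrm{proj}(\cdot,\mathcal{G}_d(\mathbb{R}^m))$ denotes the nearest-point projection. The reach of a closed subset of $(E,\|\cdot\|_\gamma)$ is the supremum of the $r\ge0$ such that every point at distance less than $r$ from the subset has a unique nearest point in it. For $X\subset E$ and $t\ge0$, $X^t=\{e\in E:\ \inf_{x\in X}\|e-x\|_\gamma\le t\}$. Set $t^{\max}_\gamma(X)=\gamma\cdot\inf\{\mathrm{dist}(A,\mathrm{med}(\mathcal{G}_d(\mathbb{R}^m))):\ (y,A)\in X\}$ (Frobenius distance). The Čech bundle filtration of $X$ is the family $(X^t)_{t\in T}$, $T=[0,t^{\max}_\gamma(X))$, with the continuous maps $p^t\colon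 X^t\to\mathcal{G}_d(\mathbb{R}^m)$, $p^t(x,A)=\mathrm{proj}(A,\mathcal{G}_d(\mathbb{R}^m))$. Let $w_i\in H^i(\mathcal{G}_d(\mathbb{R}^m))$ be the $i$-th Stiefel-Whitney class of the tautological bundle of $\mathcal{G}_d(\mathbb{R}^m)$. The $i$-th persistent Stiefel-Whitney class of $X$ at time $t\in T$ is $w_i^t(X)=(p^t)^*(w_i)\in H^i(X^t)$. The map $p$ is regarded as (a classifying map of) a $d$-dimensional vector bundle on $\mathcal{M}_0$, and the $i$-th Stiefel-Whitney class of $(\mathcal{M}_0,p)$ is $p^*(w_i)\in H^i(\mathcal{M}_0)$. *)

theory Defs
  imports "HOL-Analysis.Analysis" "HOL-Homology.Homology" "HOL-Library.Z2"
begin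

section \<open>Singular cohomology with coefficients in the field with two elements\<close>

text \<open>
  A cochain is a function on singular simplices with values in the field \<^typ>\<open>bit\<close>. It is
  normalised to vanish on functions that are not singular simplices of the space, just as
  singular simplices themselves are normalised to be extensional.
\<close>

type_synonym 'a cochain = "((nat \<Rightarrow> real) \<Rightarrow> 'a) \<Rightarrow> bit"

definition cochain_group :: "nat \<Rightarrow> 'a topology \<Rightarrow> 'a cochain monoid" where
  "cochain_group p X =
     \<lparr>carrier = {c. \<forall>\<sigma>. \<not> singular_simplex p X \<sigma> \<longrightarrow> c \<sigma> = 0},
      monoid.mult = (\<lambda>c c' \<sigma>. c \<sigma> + c' \<sigma>),
      one = (\<lambda>\<sigma>. 0)\<rparr>"

definition coboundary :: "nat \<Rightarrow> 'a topology \<Rightarrow> 'a cochain \<Rightarrow> 'a cochain" where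
  "coboundary p X c =
     (\<lambda>\<sigma>. if singular_simplex (Suc p) X \<sigma>
           then \<Sum>k\<le>Suc p. c (singular_face (Suc p) k \<sigma>) else 0)"

definition cocycles :: "nat \<Rightarrow> 'a topology \<Rightarrow> 'a cochain set" where
  "cocycles p X = {c \<in> carrier (cochain_group p X). coboundary p X c = (\<lambda>\<sigma>. 0)}"

definition coboundaries :: "nat \<Rightarrow> 'a topology \<Rightarrow> 'a cochain set" where
  "coboundaries p X =
     (case p of 0 \<Rightarrow> {\<lambda>\<sigma>. 0} | Suc q \<Rightarrow> coboundary q X ` carrier (cochain_group q X))"

definition cohomology_group :: "nat \<Rightarrow> 'a topology \<Rightarrow> 'a cochain set monoid" where
  "cohomology_group p X =
     (cochain_group p X\<lparr>carrier := cocycles p X\<rparr>) Mod (coboundaries p X)"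

definition cohomology_class :: "nat \<Rightarrow> 'a topology \<Rightarrow> 'a cochain \<Rightarrow> 'a cochain set" where
  "cohomology_class p X c = coboundaries p X #>\<^bsub>cochain_group p X\<^esub> c"

definition cochain_pullback ::
    "nat \<Rightarrow> 'a topology \<Rightarrow> ('a \<Rightarrow> 'b) \<Rightarrow> 'b cochain \<Rightarrow> 'a cochain" where
  "cochain_pullback p X f c =
     (\<lambda>\<sigma>. if singular_simplex p X \<sigma> then c (simplex_map p f \<sigma>) else 0)"

text \<open>
  The map in cohomology induced by a continuous map \<open>f\<close> from \<open>X\<close> to \<open>Y\<close>. The elements of
  a cohomology group are cosets; all representatives of a class of \<open>Y\<close> have the same image,
  so the union below is over equal sets. The target space need not be mentioned.
\<close>

definition cohomology_pullback ::
    "nat \<Rightarrow> 'a topology \<Rightarrow> ('a \<Rightarrow> 'b) \<Rightarrow> 'b cochain set \<Rightarrow> 'a cochain set" where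
  "cohomology_pullback p X f a =
     (\<Union>c\<in>a. cohomology_class p X (cochain_pullback p X f c))"

text \<open>
  The cup product evaluates the first factor on the front \<open>p\<close>-face (the first \<open>p + 1\<close>
  vertices) and the second one on the back \<open>q\<close>-face (the last \<open>q + 1\<close> vertices). The
  standard simplices lie in a common sequence space, so passing to the front face is just
  restriction.
\<close>

definition cochain_cup ::
    "nat \<Rightarrow> nat \<Rightarrow> 'a topology \<Rightarrow> 'a cochain \<Rightarrow> 'a cochain \<Rightarrow> 'a cochain" where
  "cochain_cup p q X c c' =
     (\<lambda>\<sigma>. if singular_simplex (p + q) X \<sigma>
           then c (restrict \<sigma> (standard_simplex p)) *
                c' (restrict (\<lambda>x. \<sigma> (\<lambda>i. if i < p then 0 else x (i - p))) (standard_simplex q))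
           else 0)"

definition cohomology_cup ::
    "nat \<Rightarrow> nat \<Rightarrow> 'a topology \<Rightarrow> 'a cochain set \<Rightarrow> 'a cochain set \<Rightarrow> 'a cochain set" where
  "cohomology_cup p q X a b =
     (\<Union>c\<in>a. \<Union>c'\<in>b. cohomology_class (p + q) X (cochain_cup p q X c c'))"

definition cohomology_unit :: "'a topology \<Rightarrow> 'a cochain set" where
  "cohomology_unit X =
     cohomology_class 0 X (\<lambda>\<sigma>. if singular_simplex 0 X \<sigma> then 1 else 0)"

text \<open>Cup powers of a class of degree 1.\<close>

fun cohomology_power :: "'a topology \<Rightarrow> 'a cochain set \<Rightarrow> nat \<Rightarrow> 'a cochain set" where
  "cohomology_power X a 0 = cohomology_unit X"
| "cohomology_power X a (Suc j) = cohomology_cup j 1 X (cohomology_power X a j) a"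


section \<open>Grassmannians and Stiefel--Whitney classes\<close>

text \<open>
  A \<open>d\<close>-plane is identified with the matrix of the orthogonal projection onto it. The norm of
  the type \<^typ>\<open>real^'m^'m\<close> is the Frobenius norm.
\<close>

definition grassmannian :: "nat \<Rightarrow> (real^'m^'m) set" where
  "grassmannian d = {P. P ** P = P \<and> transpose P = P \<and> rank P = d}"

text \<open>
  The projective bundle of the tautological bundle: pairs of a \<open>d\<close>-plane and a line in it.
  The line with projection \<open>L\<close> is contained in the plane with projection \<open>P\<close> if and only
  if \<open>P ** L = L\<close>. The bundle projection is \<^const>\<open>fst\<close>, and \<^const>\<open>snd\<close> classifies the
  tautological line bundle over the projective bundle.
\<close>

definition projective_tautological :: "nat \<Rightarrow> ((real^'m^'m) \<times> (real^'m^'m)) set" where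
  "projective_tautological d =
     {(P, L). P \<in> grassmannian d \<and> L \<in> grassmannian 1 \<and> P ** L = L}"

text \<open>
  The generator of the first cohomology group of the projective space of lines; for
  \<open>CARD('m) \<ge> 2\<close> this group has exactly two elements.
\<close>

definition hyperplane_class :: "(real^'m^'m) cochain set" where
  "hyperplane_class =
     (THE h. h \<in> carrier (cohomology_group 1 (top_of_set (grassmannian 1))) \<and>
             h \<noteq> \<one>\<^bsub>cohomology_group 1 (top_of_set (grassmannian 1))\<^esub>)"

definition tautological_line_class ::
    "nat \<Rightarrow> ((real^'m^'m) \<times> (real^'m^'m)) cochain set" where
  "tautological_line_class d =
     cohomology_pullback 1 (top_of_set (projective_tautological d)) snd hyperplane_class"

text \<open>
  The Stiefel--Whitney classes of the tautological bundle, by the construction through the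
  projective bundle (Grothendieck, Hirzebruch; see Husemoller's book on fibre bundles). Let
  \<open>x\<close> be the degree 1 class of the tautological line bundle on the projective bundle. By the
  Leray--Hirsch theorem the powers of \<open>x\<close> with exponent less than \<open>d\<close> form a basis over the
  cohomology of the base, so the coefficients of the monic relation
  \<open>x ^ d + w 1 x ^ (d - 1) + \<dots> + w d = 0\<close> exist and are unique. Signs are irrelevant
  modulo 2. The group operation of a cohomology group is written multiplicatively, so the sum is a
  \<^const>\<open>finprod\<close> and zero is the neutral element.
\<close>

definition is_stiefel_whitney ::
    "nat \<Rightarrow> (nat \<Rightarrow> (real^'m^'m) cochain set) \<Rightarrow> bool" where
  "is_stiefel_whitney d w \<longleftrightarrow>
     (let G = top_of_set (grassmannian d); B = top_of_set (projective_tautological d) in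
       (\<forall>i. w i \<in> carrier (cohomology_group i G)) \<and>
       w 0 = cohomology_unit G \<and>
       (\<forall>i>d. w i = \<one>\<^bsub>cohomology_group i G\<^esub>) \<and>
       finprod (cohomology_group d B)
         (\<lambda>i. cohomology_cup (d - i) i B
                (cohomology_power B (tautological_line_class d) (d - i))
                (cohomology_pullback i B fst (w i)))
         {..d} = \<one>\<^bsub>cohomology_group d B\<^esub>)"

definition stiefel_whitney :: "nat \<Rightarrow> nat \<Rightarrow> (real^'m^'m) cochain set" where
  "stiefel_whitney d = (THE w. is_stiefel_whitney d w)"


section \<open>Metric notions\<close>

definition gnorm :: "real \<Rightarrow> (real^'n) \<times> (real^'m^'m) \<Rightarrow> real" where
  "gnorm \<gamma> e = sqrt ((norm (fst e))\<^sup>2 + \<gamma>\<^sup>2 * (norm (snd e))\<^sup>2)"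

text \<open>
  Distances to sets, the Hausdorff distance and the reach are extended reals: the reach of a
  point is infinite, and so is the Hausdorff distance of a compact set to an unbounded one.
\<close>

definition gsetdist :: "real \<Rightarrow> (real^'n) \<times> (real^'m^'m) \<Rightarrow> ((real^'n) \<times> (real^'m^'m)) set \<Rightarrow> ereal" where
  "gsetdist \<gamma> e X = (INF x\<in>X. ereal (gnorm \<gamma> (e - x)))"

definition hausdorff_distance ::
    "real \<Rightarrow> ((real^'n) \<times> (real^'m^'m)) set \<Rightarrow> ((real^'n) \<times> (real^'m^'m)) set \<Rightarrow> ereal" where
  "hausdorff_distance \<gamma> X Y =
     max (SUP x\<in>X. gsetdist \<gamma> x Y) (SUP y\<in>Y. gsetdist \<gamma> y X)"

definition reach :: "real \<Rightarrow> ((real^'n) \<times> (real^'m^'m)) set \<Rightarrow> ereal" where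
  "reach \<gamma> M =
     Sup {ereal r | r. 0 \<le> r \<and>
       (\<forall>e. gsetdist \<gamma> e M < ereal r \<longrightarrow>
          (\<exists>!x. x \<in> M \<and> (\<forall>y\<in>M. gnorm \<gamma> (e - x) \<le> gnorm \<gamma> (e - y))))}"

definition offset ::
    "real \<Rightarrow> ((real^'n) \<times> (real^'m^'m)) set \<Rightarrow> real \<Rightarrow> ((real^'n) \<times> (real^'m^'m)) set" where
  "offset \<gamma> X t = {e. gsetdist \<gamma> e X \<le> ereal t}"

definition medial_axis :: "'a::metric_space set \<Rightarrow> 'a set" where
  "medial_axis S =
     {a. \<exists>x\<in>S. \<exists>y\<in>S. x \<noteq> y \<and> (\<forall>z\<in>S. dist a x \<le> dist a z) \<and> (\<forall>z\<in>S. dist a y \<le> dist a z)}"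


section \<open>The Cech bundle filtration\<close>

definition t_max :: "real \<Rightarrow> nat \<Rightarrow> ((real^'n) \<times> (real^'m^'m)) set \<Rightarrow> real" where
  "t_max \<gamma> d X = \<gamma> * (INF e\<in>X. infdist (snd e) (medial_axis (grassmannian d)))"

text \<open>
  The map \<open>p\<^sup>t\<close> is the restriction of the following map to the offset \<open>X\<^sup>t\<close>.
\<close>

definition cech_projection :: "nat \<Rightarrow> (real^'n) \<times> (real^'m^'m) \<Rightarrow> real^'m^'m" where
  "cech_projection d e = closest_point (grassmannian d) (snd e)"

definition persistent_stiefel_whitney ::
    "real \<Rightarrow> nat \<Rightarrow> ((real^'n) \<times> (real^'m^'m)) set \<Rightarrow> nat \<Rightarrow> real
      \<Rightarrow> ((real^'n) \<times> (real^'m^'m)) cochain set" where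
  "persistent_stiefel_whitney \<gamma> d X i t =
     cohomology_pullback i (top_of_set (offset \<gamma> X t)) (cech_projection d) (stiefel_whitney d i)"


section \<open>Manifolds and immersions of finite differentiability class\<close>

text \<open>
  Functions of class \<open>C\<^sup>r\<close> on a set \<open>U\<close> that is open in \<open>k\<close>-dimensional Euclidean space:
  the iterated partial derivatives up to order \<open>r\<close> exist and are continuous. The library's
  \<^const>\<open>Euclidean_space\<close> consists of the sequences that vanish from index \<open>k\<close> on, which
  allows every dimension \<open>k\<close>, including 0.
\<close>

fun Cr_on :: "nat \<Rightarrow> nat \<Rightarrow> (nat \<Rightarrow> real) set \<Rightarrow> ((nat \<Rightarrow> real) \<Rightarrow> real) \<Rightarrow> bool" where
  "Cr_on k 0 U f \<longleftrightarrow>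
     continuous_map (subtopology (Euclidean_space k) U) euclideanreal f"
| "Cr_on k (Suc r) U f \<longleftrightarrow>
     continuous_map (subtopology (Euclidean_space k) U) euclideanreal f \<and>
     (\<forall>i<k. \<exists>g. Cr_on k r U g \<and>
        (\<forall>x\<in>U. ((\<lambda>s. f (x(i := s))) has_real_derivative g x) (at (x i))))"

type_synonym 'a atlas = "('a set \<times> ('a \<Rightarrow> nat \<Rightarrow> real)) set"

definition Cr_manifold :: "nat \<Rightarrow> nat \<Rightarrow> 'a topology \<Rightarrow> 'a atlas \<Rightarrow> bool" where
  "Cr_manifold r k M \<A> \<longleftrightarrow>
     Hausdorff_space M \<and> second_countable M \<and>
     (\<Union>(U, \<phi>)\<in>\<A>. U) = topspace M \<and>
     (\<forall>(U, \<phi>)\<in>\<A>. openin M U \<and> openin (Euclidean_space k) (\<phi> ` U) \<and>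
        homeomorphic_map (subtopology M U) (subtopology (Euclidean_space k) (\<phi> ` U)) \<phi>) \<and>
     (\<forall>(U, \<phi>)\<in>\<A>. \<forall>(V, \<psi>)\<in>\<A>. \<forall>j<k.
        Cr_on k r (\<phi> ` (U \<inter> V)) (\<lambda>x. \<psi> (inv_into U \<phi> x) j))"

text \<open>
  An immersion is of the class of the manifold, and in every chart its partial derivatives
  are linearly independent, i.e. its differential is injective.
\<close>

definition Cr_immersion ::
    "nat \<Rightarrow> nat \<Rightarrow> 'a atlas \<Rightarrow> ('a \<Rightarrow> real^'n) \<Rightarrow> bool" where
  "Cr_immersion r k \<A> u \<longleftrightarrow>
     (\<forall>(U, \<phi>)\<in>\<A>.
        (\<forall>j. Cr_on k r (\<phi> ` U) (\<lambda>x. u (inv_into U \<phi> x) $ j)) \<and>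
        (\<forall>x\<in>\<phi> ` U. \<forall>a :: nat \<Rightarrow> real.
           (\<Sum>i<k. a i *\<^sub>R
              vector_derivative (\<lambda>s. u (inv_into U \<phi> (x(i := s)))) (at (x i))) = 0
           \<longrightarrow> (\<forall>i<k. a i = 0)))"

end

theory Submission
  imports Defs
begin

text \<open>
  Let \<open>\<pi>\<close> be the nearest-point projection onto \<open>M\<close>, the image of \<open>u_check\<close>. Below the reach it
  is defined and continuous, and the straight line from \<open>x\<close> to \<open>\<pi> x\<close> never leaves the offset
  of \<open>X\<close>: by Federer's inequality \<open>2 R \<langle>x - \<pi> x, q - \<pi> x\<rangle> \<le> |x - \<pi> x| |q - \<pi> x|\<^sup>2\<close>
  for \<open>q \<in> M\<close>, with \<open>R = t + 3 \<epsilon>\<close>. So \<open>\<pi>\<close> is a deformation retraction of the offset onto \<open>M\<close>, and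
  the isomorphism follows from the homotopy invariance of cohomology, by the prism operator.
  The statement on characteristic classes holds because the Cech projection composed with
  \<open>u_check\<close> is \<open>p\<close>; only functoriality of the pullback matters, not which classes are pulled back.
\<close>

section \<open>Functoriality of mod 2 cohomology\<close>

text \<open>Otherwise the simplifier turns sums of bits into exclusive ors of their parities.\<close>

declare add_bit_eq_xor [simp del]

lemma cohomology_class_eq:
  "cohomology_class p X c = {\<lambda>\<sigma>. b \<sigma> + c \<sigma> | b. b \<in> coboundaries p X}"
  by (auto simp: cohomology_class_def r_coset_def cochain_group_def)

lemma coboundary_add:
  "coboundary p X (\<lambda>\<sigma>. c \<sigma> + d \<sigma>) = (\<lambda>\<sigma>. coboundary p X c \<sigma> + coboundary p X d \<sigma>)"
  by (auto simp: coboundary_def sum.distrib fun_eq_iff simp del: sum.atMost_Suc)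

lemma coboundary_zero: "coboundary p X (\<lambda>\<sigma>. 0) = (\<lambda>\<sigma>. 0)"
  by (auto simp: coboundary_def)

lemma zero_in_coboundaries: "(\<lambda>\<sigma>. 0) \<in> coboundaries p X"
  by (cases p) (force simp: coboundaries_def cochain_group_def coboundary_zero intro: image_eqI[where x="\<lambda>\<sigma>. 0"])+

lemma coboundaries_add:
  assumes "b \<in> coboundaries p X" "b' \<in> coboundaries p X"
  shows "(\<lambda>\<sigma>. b \<sigma> + b' \<sigma>) \<in> coboundaries p X"
proof (cases p)
  case 0
  then show ?thesis using assms by (simp add: coboundaries_def)
next
  case (Suc q)
  then obtain c c' where "c \<in> carrier (cochain_group q X)" "c' \<in> carrier (cochain_group q X)"
    "b = coboundary q X c" "b' = coboundary q X c'"
    using assms by (auto simp: coboundaries_def)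
  then show ?thesis
    unfolding Suc coboundaries_def
    by (auto simp: cochain_group_def coboundary_add intro!: image_eqI[where x="\<lambda>\<sigma>. c \<sigma> + c' \<sigma>"])
qed

lemma cohomology_class_add_coboundary:
  assumes "b \<in> coboundaries p X"
  shows "cohomology_class p X (\<lambda>\<sigma>. b \<sigma> + c \<sigma>) = cohomology_class p X c"
proof -
  have "(\<lambda>\<sigma>. b' \<sigma> + (b \<sigma> + c \<sigma>)) \<in> cohomology_class p X c" if "b' \<in> coboundaries p X" for b'
    using coboundaries_add[OF that assms] by (force simp: cohomology_class_eq add.assoc)
  moreover have "(\<lambda>\<sigma>. b' \<sigma> + c \<sigma>) \<in> cohomology_class p X (\<lambda>\<sigma>. b \<sigma> + c \<sigma>)"
    if "b' \<in> coboundaries p X" for b'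
  proof -
    \<comment> \<open>Characteristic two: \<open>b\<close> is its own negative, so adding it twice
      changes nothing.\<close>
    have "(\<lambda>\<sigma>. b' \<sigma> + c \<sigma>) = (\<lambda>\<sigma>. (b' \<sigma> + b \<sigma>) + (b \<sigma> + c \<sigma>))"
      by (simp add: add.assoc fun_eq_iff flip: add.assoc[of "b _" "b _"])
    then show ?thesis
      using coboundaries_add[OF that assms] by (force simp: cohomology_class_eq)
  qed
  ultimately show ?thesis
    by (auto simp: cohomology_class_eq)
qed

lemma carrier_cohomology_group:
  "carrier (cohomology_group p X) = cohomology_class p X ` cocycles p X"
  by (auto simp: cohomology_group_def FactGroup_def RCOSETS_def cohomology_class_def
      r_coset_def cochain_group_def)

text \<open>The product in the quotient is the set product of cosets. It collapses to a single coset
  because the coboundaries contain zero and are closed under addition.\<close>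

lemma mult_cohomology_group:
  "cohomology_class p X c \<otimes>\<^bsub>cohomology_group p X\<^esub> cohomology_class p X c' =
   cohomology_class p X (\<lambda>\<sigma>. c \<sigma> + c' \<sigma>)"
proof -
  have "cohomology_class p X c \<otimes>\<^bsub>cohomology_group p X\<^esub> cohomology_class p X c' =
    {\<lambda>\<sigma>. (b \<sigma> + c \<sigma>) + (b' \<sigma> + c' \<sigma>) | b b'. b \<in> coboundaries p X \<and> b' \<in> coboundaries p X}"
    by (auto simp: cohomology_group_def FactGroup_def set_mult_def cohomology_class_eq
        cochain_group_def)
  also have "\<dots> = cohomology_class p X (\<lambda>\<sigma>. c \<sigma> + c' \<sigma>)"
  proof (intro equalityI subsetI)
    fix a assume "a \<in> {\<lambda>\<sigma>. (b \<sigma> + c \<sigma>) + (b' \<sigma> + c' \<sigma>) | b b'.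
      b \<in> coboundaries p X \<and> b' \<in> coboundaries p X}"
    then obtain b b' where "b \<in> coboundaries p X" "b' \<in> coboundaries p X"
      and a: "a = (\<lambda>\<sigma>. (b \<sigma> + b' \<sigma>) + (c \<sigma> + c' \<sigma>))"
      by (auto simp: algebra_simps)
    then show "a \<in> cohomology_class p X (\<lambda>\<sigma>. c \<sigma> + c' \<sigma>)"
      using coboundaries_add by (force simp: cohomology_class_eq)
  next
    fix a assume "a \<in> cohomology_class p X (\<lambda>\<sigma>. c \<sigma> + c' \<sigma>)"
    then obtain b where "b \<in> coboundaries p X" "a = (\<lambda>\<sigma>. (b \<sigma> + c \<sigma>) + (0 + c' \<sigma>))"
      by (auto simp: cohomology_class_eq add.assoc)
    then show "a \<in> {\<lambda>\<sigma>. (b \<sigma> + c \<sigma>) + (b' \<sigma> + c' \<sigma>) | b b'.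
      b \<in> coboundaries p X \<and> b' \<in> coboundaries p X}"
      using zero_in_coboundaries[of p X] by fast
  qed
  finally show ?thesis .
qed

section \<open>Pullbacks of cochains and of cohomology classes\<close>

lemma cochain_pullback_add:
  "cochain_pullback p X f (\<lambda>\<sigma>. c \<sigma> + d \<sigma>) =
   (\<lambda>\<sigma>. cochain_pullback p X f c \<sigma> + cochain_pullback p X f d \<sigma>)"
  by (auto simp: cochain_pullback_def)

lemma cochain_pullback_in_carrier: "cochain_pullback p X f c \<in> carrier (cochain_group p X)"
  by (auto simp: cochain_pullback_def cochain_group_def)

lemma singular_face_simplex_map_eq:
  assumes "k \<le> Suc p"
  shows "singular_face (Suc p) k (simplex_map (Suc p) f \<sigma>) = simplex_map p f (singular_face (Suc p) k \<sigma>)"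
  using singular_face_simplex_map[of "Suc p" k f \<sigma>] assms
  by (auto simp: simplex_map_def singular_face_def)

text \<open>Composition with \<open>f\<close> commutes with taking faces. Continuity of
  \<open>f\<close> keeps images of singular simplices singular, so that
  \<open>coboundary p Y c\<close> does not fall back to its default 0 on them.\<close>

lemma cochain_pullback_coboundary:
  assumes "continuous_map X Y f"
  shows "cochain_pullback (Suc p) X f (coboundary p Y c) = coboundary p X (cochain_pullback p X f c)"
proof
  fix \<sigma>
  show "cochain_pullback (Suc p) X f (coboundary p Y c) \<sigma> = coboundary p X (cochain_pullback p X f c) \<sigma>"
  proof (cases "singular_simplex (Suc p) X \<sigma>")
    case True
    then have "singular_simplex (Suc p) Y (simplex_map (Suc p) f \<sigma>)"
      using assms singular_simplex_simplex_map by blast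
    moreover have "singular_simplex p X (singular_face (Suc p) k \<sigma>)" if "k \<le> Suc p" for k
      using singular_simplex_singular_face[OF True _ that] by simp
    ultimately show ?thesis
      using True by (auto simp: cochain_pullback_def coboundary_def singular_face_simplex_map_eq
          simp del: sum.atMost_Suc intro!: sum.cong)
  qed (auto simp: cochain_pullback_def coboundary_def)
qed

lemma cochain_pullback_cocycle:
  assumes "continuous_map X Y f" "c \<in> cocycles p Y"
  shows "cochain_pullback p X f c \<in> cocycles p X"
proof -
  have "cochain_pullback (Suc p) X f (\<lambda>\<sigma>. 0) = (\<lambda>\<sigma>. 0)"
    by (auto simp: cochain_pullback_def)
  then show ?thesis
    using assms cochain_pullback_coboundary[OF assms(1), of p c]
    by (auto simp: cocycles_def cochain_pullback_in_carrier)
qed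

lemma cochain_pullback_coboundaries:
  assumes "continuous_map X Y f" "b \<in> coboundaries p Y"
  shows "cochain_pullback p X f b \<in> coboundaries p X"
proof (cases p)
  case 0
  with assms show ?thesis
    by (auto simp: coboundaries_def cochain_pullback_def)
next
  case (Suc q)
  with assms obtain c where "b = coboundary q Y c"
    by (auto simp: coboundaries_def)
  then show ?thesis
    using assms(1) unfolding Suc coboundaries_def
    by (auto simp: cochain_pullback_coboundary cochain_pullback_in_carrier)
qed

text \<open>Two representatives of a class differ by a coboundary, whose pullback is a coboundary;
  so the union in \<open>cohomology_pullback\<close> is a nonempty union of equal cosets.\<close>

lemma cohomology_pullback_class:
  assumes "continuous_map X Y f"
  shows "cohomology_pullback p X f (cohomology_class p Y c) =
         cohomology_class p X (cochain_pullback p X f c)"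
proof -
  have "cohomology_class p X (cochain_pullback p X f c') = cohomology_class p X (cochain_pullback p X f c)"
    if "c' \<in> cohomology_class p Y c" for c'
    using that cochain_pullback_coboundaries[OF assms]
    by (auto simp: cohomology_class_eq[of p Y] cochain_pullback_add cohomology_class_add_coboundary)
  moreover have "cohomology_class p Y c \<noteq> {}"
    using zero_in_coboundaries by (auto simp: cohomology_class_eq)
  ultimately show ?thesis
    by (auto simp: cohomology_pullback_def)
qed

text \<open>Proved on cochains, for an arbitrary set \<open>a\<close> and an arbitrary map
  \<open>g\<close>, so that it applies directly to \<open>stiefel_whitney d i\<close> and
  \<open>cech_projection d\<close>.\<close>

lemma cohomology_pullback_compose:
  assumes "continuous_map X Y f"
  shows "cohomology_pullback p X f (cohomology_pullback p Y g a) = cohomology_pullback p X (g \<circ> f) a"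
proof -
  have *: "cochain_pullback p X f (cochain_pullback p Y g c) = cochain_pullback p X (g \<circ> f) c" for c
    using singular_simplex_simplex_map[OF _ assms]
    by (auto simp: cochain_pullback_def simplex_map_compose fun_eq_iff)
  have "cohomology_pullback p X f (cohomology_pullback p Y g a) =
    (\<Union>c\<in>a. cohomology_pullback p X f (cohomology_class p Y (cochain_pullback p Y g c)))"
    by (auto simp: cohomology_pullback_def)
  then show ?thesis
    by (simp add: cohomology_pullback_class[OF assms] * cohomology_pullback_def[of p X "g \<circ> f"])
qed

lemma cohomology_pullback_cong:
  assumes "\<And>x. x \<in> topspace X \<Longrightarrow> f x = g x"
  shows "cohomology_pullback p X f a = cohomology_pullback p X g a"
proof -
  have "cochain_pullback p X f c = cochain_pullback p X g c" for c
  proof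
    fix \<sigma>
    have "simplex_map p f \<sigma> = simplex_map p g \<sigma>" if "singular_simplex p X \<sigma>"
      using that assms by (rule simplex_map_eq)
    then show "cochain_pullback p X f c \<sigma> = cochain_pullback p X g c \<sigma>"
      by (simp add: cochain_pullback_def)
  qed
  then show ?thesis
    by (simp add: cohomology_pullback_def)
qed

lemma cohomology_pullback_id:
  assumes "a \<in> carrier (cohomology_group p X)"
  shows "cohomology_pullback p X id a = a"
proof -
  obtain c where c: "c \<in> cocycles p X" "a = cohomology_class p X c"
    using assms by (auto simp: carrier_cohomology_group)
  \<comment> \<open>Pulling back along \<open>id\<close> only cuts \<open>c\<close> off outside the
    singular simplices of \<open>X\<close>, where a normalised cochain vanishes already.\<close>
  have "cochain_pullback p X id c = c"
  proof
    fix \<sigma> show "cochain_pullback p X id c \<sigma> = c \<sigma>"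
      using c(1) simplex_map_id_gen[of p X \<sigma> id]
      by (auto simp: cochain_pullback_def cocycles_def cochain_group_def simp del: simplex_map_id)
  qed
  then show ?thesis
    using c(2) by (simp add: cohomology_pullback_class)
qed

lemma cohomology_pullback_hom:
  assumes "continuous_map X Y f"
  shows "cohomology_pullback p X f \<in> hom (cohomology_group p Y) (cohomology_group p X)"
  by (auto simp: hom_def carrier_cohomology_group mult_cohomology_group cochain_pullback_add
      cohomology_pullback_class[OF assms] cochain_pullback_cocycle[OF assms])

section \<open>Homotopy invariance\<close>

text \<open>In barycentric coordinates, the affine codegeneracy map that merges the vertices
  \<open>i\<close> and \<open>i + 1\<close>.\<close>

definition degeneracy :: "nat \<Rightarrow> (nat \<Rightarrow> real) \<Rightarrow> nat \<Rightarrow> real" where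
  "degeneracy i x = (\<lambda>j. if j < i then x j else if j = i then x i + x (Suc i) else x (Suc j))"

text \<open>The \<open>i\<close>-th simplex of the usual triangulation of the cylinder over a
  \<open>q\<close>-simplex, followed by \<open>h\<close>: its vertices 0 to \<open>i\<close> lie at
  time 0, the later ones at time 1, and its vertices \<open>i\<close> and \<open>i + 1\<close> lie
  over the same point.\<close>

definition prism :: "nat \<Rightarrow> (real \<times> 'a \<Rightarrow> 'b) \<Rightarrow> nat \<Rightarrow> ((nat \<Rightarrow> real) \<Rightarrow> 'a) \<Rightarrow> (nat \<Rightarrow> real) \<Rightarrow> 'b" where
  "prism q h i \<sigma> = (\<lambda>x \<in> standard_simplex (Suc q). h (1 - (\<Sum>j\<le>i. x j), \<sigma> (degeneracy i x)))"

lemma sum_degeneracy: 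
  assumes "i \<le> q"
  shows "(\<Sum>j\<le>q. degeneracy i x j) = (\<Sum>j\<le>Suc q. x j)"
  using assms
proof (induction q rule: dec_induct)
  case base
  have "(\<Sum>j\<le>i. degeneracy i x j) = (\<Sum>j<i. x j) + (x i + x (Suc i))"
    by (simp add: degeneracy_def lessThan_Suc_atMost[symmetric])
  then show ?case by (simp add: lessThan_Suc_atMost[symmetric])
qed (simp add: degeneracy_def)

lemma degeneracy_in_standard_simplex:
  assumes "x \<in> standard_simplex (Suc q)" "i \<le> q"
  shows "degeneracy i x \<in> standard_simplex q"
proof -
  have nonneg: "degeneracy i x j \<ge> 0" for j
    using assms by (auto simp: degeneracy_def standard_simplex_def)
  have zero: "degeneracy i x j = 0" if "j > q" for j
    using assms that by (auto simp: degeneracy_def standard_simplex_def)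
  have sum: "(\<Sum>j\<le>q. degeneracy i x j) = 1"
    using assms by (simp only: sum_degeneracy standard_simplex_def mem_Collect_eq)
  have "degeneracy i x j \<le> 1" for j
  proof (cases "j \<le> q")
    case True
    then show ?thesis
      using member_le_sum[of j "{..q}" "degeneracy i x"] nonneg sum by simp
  qed (use zero in simp)
  then show ?thesis
    using nonneg zero sum by (simp add: standard_simplex_def)
qed

lemma prism_time_in_unit_interval:
  assumes "x \<in> standard_simplex q" "i \<le> q"
  shows "1 - (\<Sum>j\<le>i. x j) \<in> {0..1}"
proof -
  have "(\<Sum>j\<le>i. x j) \<le> (\<Sum>j\<le>q. x j)"
    using assms by (intro sum_mono2) (auto simp: standard_simplex_def)
  moreover have "(\<Sum>j\<le>i. x j) \<ge> 0"
    using assms by (intro sum_nonneg) (auto simp: standard_simplex_def)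
  ultimately show ?thesis
    using assms by (auto simp: standard_simplex_def)
qed

lemma singular_simplex_prism:
  assumes h: "continuous_map (prod_topology (top_of_set {0..1}) X) Y h"
    and \<sigma>: "singular_simplex q X \<sigma>" and i: "i \<le> q"
  shows "singular_simplex (Suc q) Y (prism q h i \<sigma>)"
proof -
  let ?S = "\<lambda>q. subtopology (powertop_real UNIV) (standard_simplex q)"
  have proj: "continuous_map (?S (Suc q)) euclideanreal (\<lambda>x. x j)" for j
    by (intro continuous_map_from_subtopology continuous_map_product_projection) auto
  have "continuous_map (?S (Suc q)) euclideanreal (\<lambda>x. degeneracy i x j)" for j
    using proj by (cases "j < i"; cases "j = i") (auto simp: degeneracy_def intro!: continuous_map_add)
  then have "continuous_map (?S (Suc q)) (?S q) (degeneracy i)"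
    using degeneracy_in_standard_simplex[OF _ i]
    by (auto simp: continuous_map_in_subtopology continuous_map_componentwise)
  then have "continuous_map (?S (Suc q)) X (\<sigma> \<circ> degeneracy i)"
    using \<sigma> continuous_map_compose unfolding singular_simplex_def by blast
  moreover have "continuous_map (?S (Suc q)) (top_of_set {0..1}) (\<lambda>x. 1 - (\<Sum>j\<le>i. x j))"
    using prism_time_in_unit_interval[of _ "Suc q" i] i proj
    by (auto simp: continuous_map_in_subtopology intro!: continuous_map_diff continuous_map_sum)
  ultimately have "continuous_map (?S (Suc q)) (prod_topology (top_of_set {0..1}) X)
      (\<lambda>x. (1 - (\<Sum>j\<le>i. x j), (\<sigma> \<circ> degeneracy i) x))"
    by (intro continuous_map_pairedI)
  from continuous_map_compose[OF this h] show ?thesis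
    by (auto simp: singular_simplex_def prism_def o_def elim!: continuous_map_eq)
qed

section \<open>Faces of prism simplices and the prism formula\<close>

lemma sum_simplical_face:
  "(\<Sum>j\<le>i. simplical_face k x j) = (if k \<le> i then (\<Sum>j<i. x j) else (\<Sum>j\<le>i. x j))"
  for x :: "nat \<Rightarrow> real"
proof (induction i)
  case (Suc i)
  then show ?case
    by (auto simp: simplical_face_def lessThan_Suc_atMost[symmetric] not_less_eq_eq le_Suc_eq)
qed (auto simp: simplical_face_def)

text \<open>These are the cosimplicial identities between cofaces and codegeneracies.\<close>

lemma degeneracy_simplical_face:
  shows degeneracy_simplical_face_low:
      "k \<le> i \<Longrightarrow> degeneracy (Suc i) (simplical_face k x) = simplical_face k (degeneracy i x)"
    and degeneracy_simplical_face_high: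
      "i < k \<Longrightarrow> degeneracy i (simplical_face (Suc k) x) = simplical_face k (degeneracy i x)"
    and degeneracy_simplical_face_same: "degeneracy i (simplical_face i x) = x"
    and degeneracy_simplical_face_Suc: "degeneracy i (simplical_face (Suc i) x) = x"
proof -
  show "k \<le> i \<Longrightarrow> degeneracy (Suc i) (simplical_face k x) = simplical_face k (degeneracy i x)"
    by (rule ext) (auto simp: degeneracy_def simplical_face_def; metis Suc_pred less_Suc_eq_0_disj not_less_eq)
  show "i < k \<Longrightarrow> degeneracy i (simplical_face (Suc k) x) = simplical_face k (degeneracy i x)"
    by (rule ext) (auto simp: degeneracy_def simplical_face_def)
  show "degeneracy i (simplical_face i x) = x" "degeneracy i (simplical_face (Suc i) x) = x"
    by (auto simp: degeneracy_def simplical_face_def fun_eq_iff)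
qed

lemma singular_face_prism:
  assumes "k \<le> Suc q"
  shows "singular_face (Suc q) k (prism q h i \<sigma>) =
    (\<lambda>x\<in>standard_simplex q. h (1 - (\<Sum>j\<le>i. simplical_face k x j), \<sigma> (degeneracy i (simplical_face k x))))"
  using assms simplical_face_in_standard_simplex[of "Suc q" k]
  by (auto simp: singular_face_def prism_def)

text \<open>Dropping a vertex off the vertical edge leaves a prism simplex over a face of
  \<open>\<sigma>\<close>. Here the vertex comes before that edge, so the edge moves down by one
  index; in \<open>singular_face_prism_high\<close> it comes after, and the edge keeps its
  index.\<close>

lemma singular_face_prism_low:
  assumes "k \<le> i" "i \<le> q"
  shows "singular_face (Suc (Suc q)) k (prism (Suc q) h (Suc i) \<sigma>) = prism q h i (singular_face (Suc q) k \<sigma>)"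
  using assms degeneracy_in_standard_simplex[of _ q i]
  by (subst singular_face_prism) (auto simp: prism_def singular_face_def degeneracy_simplical_face_low
      sum_simplical_face lessThan_Suc_atMost simp del: sum.atMost_Suc)

lemma singular_face_prism_high:
  assumes "i < k" "k \<le> Suc q"
  shows "singular_face (Suc (Suc q)) (Suc k) (prism (Suc q) h i \<sigma>) = prism q h i (singular_face (Suc q) k \<sigma>)"
  using assms degeneracy_in_standard_simplex[of _ q i]
  by (subst singular_face_prism) (auto simp: prism_def singular_face_def degeneracy_simplical_face_high
      sum_simplical_face simp del: sum.atMost_Suc)

text \<open>Every inner term occurs twice and cancels modulo 2, as do the common walls of
  neighbouring prism simplices.\<close>

lemma bit_sum_telescope: "(\<Sum>i\<le>q. E i + E (Suc i)) = E 0 + E (Suc q)" for E :: "nat \<Rightarrow> bit"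
proof (induction q)
  case (Suc q)
  have "E (Suc q) + E (Suc q) = 0" by (cases "E (Suc q)") auto
  then have "E 0 + E (Suc q) + (E (Suc q) + E (Suc (Suc q))) = E 0 + E (Suc (Suc q))"
    by (metis add.assoc add_0)
  then show ?case using Suc by simp
qed simp

text \<open>The bookkeeping of the prism formula. \<open>A k i\<close> stands for the value on the
  \<open>k\<close>-th face of the \<open>i\<close>-th prism simplex, \<open>B k i\<close> for the
  value on the \<open>i\<close>-th prism simplex over the \<open>k\<close>-th face, and
  \<open>E\<close> for the values on the walls, the outermost two being the ends of the
  cylinder.\<close>

lemma prism_double_sum:
  fixes A B :: "nat \<Rightarrow> nat \<Rightarrow> bit"
  assumes low: "\<And>k i. k \<le> i \<Longrightarrow> i < q \<Longrightarrow> A k (Suc i) = B k i"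
    and high: "\<And>k i. i < k \<Longrightarrow> k \<le> q \<Longrightarrow> A (Suc k) i = B k i"
    and diag: "\<And>i. i \<le> q \<Longrightarrow> A i i = E i" "\<And>i. i \<le> q \<Longrightarrow> A (Suc i) i = E (Suc i)"
  shows "(\<Sum>i\<le>q. \<Sum>k\<le>Suc q. A k i) = E 0 + E (Suc q) + (\<Sum>k\<le>q. \<Sum>i<q. B k i)"
proof -
  have split: "(\<Sum>k\<le>Suc q. A k i) = (\<Sum>k<i. A k i) + (E i + E (Suc i)) + (\<Sum>k\<in>{i<..q}. B k i)"
    if "i \<le> q" for i
  proof -
    \<comment> \<open>Faces before the walls, the two walls, and faces after them; the last are
      reindexed by \<open>Suc\<close> to fit \<open>high\<close>.\<close>
    have eq: "{..Suc q} = {..<i} \<union> ({i, Suc i} \<union> Suc ` {i<..q})"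
    proof (intro equalityI subsetI)
      fix k assume "k \<in> {..Suc q}"
      then show "k \<in> {..<i} \<union> ({i, Suc i} \<union> Suc ` {i<..q})"
        by (cases k) (auto simp: image_iff)
    qed (use that in auto)
    have "(\<Sum>k\<le>Suc q. A k i) = (\<Sum>k<i. A k i) + ((\<Sum>k\<in>{i, Suc i}. A k i) + (\<Sum>k\<in>Suc ` {i<..q}. A k i))"
      unfolding eq by (subst sum.union_disjoint; (subst sum.union_disjoint)?) auto
    also have "(\<Sum>k\<in>Suc ` {i<..q}. A k i) = (\<Sum>k\<in>{i<..q}. B k i)"
      using high by (auto simp: sum.reindex)
    finally show ?thesis
      using diag that by (simp add: add.assoc)
  qed
  \<comment> \<open>The summand for \<open>i = 0\<close> is empty, so the index can be shifted to
    fit \<open>low\<close>.\<close>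
  have "(\<Sum>i\<le>q. \<Sum>k<i. A k i) = (\<Sum>i<q. \<Sum>k\<le>i. B k i)"
    using low by (simp add: sum.atMost_shift lessThan_Suc_atMost)
  \<comment> \<open>The summand for \<open>i = q\<close> is empty.\<close>
  moreover have "(\<Sum>i\<le>q. \<Sum>k\<in>{i<..q}. B k i) = (\<Sum>i<q. \<Sum>k\<in>{i<..q}. B k i)"
    by (simp flip: lessThan_Suc_atMost)
  moreover have "(\<Sum>k\<le>i. B k i) + (\<Sum>k\<in>{i<..q}. B k i) = (\<Sum>k\<le>q. B k i)" if "i < q" for i
    using that by (subst sum.union_disjoint[symmetric]) (auto intro!: sum.cong)
  ultimately have "(\<Sum>i\<le>q. \<Sum>k<i. A k i) + (\<Sum>i\<le>q. \<Sum>k\<in>{i<..q}. B k i) = (\<Sum>i<q. \<Sum>k\<le>q. B k i)"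
    by (simp flip: sum.distrib)
  also have "\<dots> = (\<Sum>k\<le>q. \<Sum>i<q. B k i)"
    by (rule sum.swap)
  finally have "(\<Sum>i\<le>q. \<Sum>k<i. A k i) + (\<Sum>i\<le>q. \<Sum>k\<in>{i<..q}. B k i) = (\<Sum>k\<le>q. \<Sum>i<q. B k i)" .
  then show ?thesis
    by (simp add: split sum.distrib[where A = "{..q}"] bit_sum_telescope[unfolded sum.distrib] ac_simps 
      del: sum.atMost_Suc)
qed

text \<open>The boundary of the cylinder consists of its two ends and of the cylinders over the
  faces of \<open>\<sigma>\<close>; modulo 2 there are no signs. For \<open>q = 0\<close> the last
  sum is empty, so the truncated \<open>q - 1\<close> does no harm.\<close>

lemma coboundary_prism:
  assumes h: "continuous_map (prod_topology (top_of_set {0..1}) X) Y h"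
    and \<sigma>: "singular_simplex q X \<sigma>"
  shows "(\<Sum>i\<le>q. coboundary q Y c (prism q h i \<sigma>)) =
    c (simplex_map q (\<lambda>x. h (1, x)) \<sigma>) + c (simplex_map q (\<lambda>x. h (0, x)) \<sigma>) +
    (\<Sum>k\<le>q. \<Sum>i<q. c (prism (q - 1) h i (singular_face q k \<sigma>)))"
proof -
  \<comment> \<open>The wall on which the first \<open>j\<close> vertices lie at time 0 and the
    others at time 1. Thus \<open>E 0\<close> belongs to the end at time 1 and
    \<open>E (Suc q)\<close> to the end at time 0.\<close>
  define E where "E j = c (\<lambda>x\<in>standard_simplex q. h (1 - (\<Sum>l<j. x l), \<sigma> x))" for j
  have "(\<Sum>i\<le>q. coboundary q Y c (prism q h i \<sigma>)) =
    (\<Sum>i\<le>q. \<Sum>k\<le>Suc q. c (singular_face (Suc q) k (prism q h i \<sigma>)))"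
    using singular_simplex_prism[OF h \<sigma>] by (simp add: coboundary_def del: sum.atMost_Suc)
  also have "\<dots> = E 0 + E (Suc q) + (\<Sum>k\<le>q. \<Sum>i<q. c (prism (q - 1) h i (singular_face q k \<sigma>)))"
  proof (rule prism_double_sum)
    fix k i assume "k \<le> i" "i < q"
    then show "c (singular_face (Suc q) k (prism q h (Suc i) \<sigma>)) = c (prism (q - 1) h i (singular_face q k \<sigma>))"
      by (cases q) (simp_all add: singular_face_prism_low)
  next
    fix k i assume "i < k" "k \<le> q"
    then show "c (singular_face (Suc q) (Suc k) (prism q h i \<sigma>)) = c (prism (q - 1) h i (singular_face q k \<sigma>))"
      by (cases q) (simp_all add: singular_face_prism_high)
  qed (simp_all add: E_def singular_face_prism sum_simplical_face degeneracy_simplical_face_same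
        degeneracy_simplical_face_Suc lessThan_Suc_atMost restrict_def del: sum.atMost_Suc)
  also have "E 0 = c (simplex_map q (\<lambda>x. h (1, x)) \<sigma>)"
    by (simp add: E_def simplex_map_def o_def)
  also have "E (Suc q) = c (simplex_map q (\<lambda>x. h (0, x)) \<sigma>)"
    unfolding E_def simplex_map_def o_def lessThan_Suc_atMost
    by (intro arg_cong[where f = c] restrict_ext) (simp add: standard_simplex_def)
  finally show ?thesis .
qed

text \<open>On a cocycle the left side of \<open>coboundary_prism\<close> vanishes; what remains
  says that the two pullbacks differ by the coboundary of a prism cochain. Their difference
  \<open>b\<close> is written as a sum, which is the same modulo 2.\<close>

lemma cohomology_pullback_homotopic:
  fixes X :: "'a topology" and Y :: "'b topology"
  assumes "homotopic_with (\<lambda>_. True) X Y f g" "a \<in> carrier (cohomology_group p Y)"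
  shows "cohomology_pullback p X f a = cohomology_pullback p X g a"
proof -
  obtain h :: "real \<times> 'a \<Rightarrow> 'b" where h: "continuous_map (prod_topology (top_of_set {0..1}) X) Y h"
    and h0: "\<And>x. h (0, x) = f x" and h1: "\<And>x. h (1, x) = g x"
    using assms(1) by (auto simp: homotopic_with_def)
  have fg: "continuous_map X Y f" "continuous_map X Y g"
    using homotopic_with_imp_continuous_maps[OF assms(1)] by auto
  obtain c where c: "c \<in> cocycles p Y" "a = cohomology_class p Y c"
    using assms(2) by (auto simp: carrier_cohomology_group)
  define b where "b = (\<lambda>\<sigma>. cochain_pullback p X g c \<sigma> + cochain_pullback p X f c \<sigma>)"
  have b: "b \<sigma> = (\<Sum>k\<le>p. \<Sum>i<p. c (prism (p - 1) h i (singular_face p k \<sigma>)))"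
    if "singular_simplex p X \<sigma>" for \<sigma>
  proof -
    have "b \<sigma> + (\<Sum>k\<le>p. \<Sum>i<p. c (prism (p - 1) h i (singular_face p k \<sigma>))) = 0"
      using coboundary_prism[OF h that, of c] c(1) that
      by (simp add: cocycles_def b_def cochain_pullback_def h0 h1)
    then show ?thesis
      by (simp add: add_eq_0_iff)
  qed
  have "b \<in> coboundaries p X"
  proof (cases p)
    case 0
    \<comment> \<open>In degree 0 the sum over prisms is empty, and zero is the only
      coboundary.\<close>
    have "b = (\<lambda>\<sigma>. 0)"
    proof
      fix \<sigma> show "b \<sigma> = 0"
        using b[of \<sigma>] 0 by (cases "singular_simplex p X \<sigma>") (auto simp: b_def cochain_pullback_def)
    qed
    then show ?thesis
      by (simp add: zero_in_coboundaries)
  next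
    case (Suc r)
    \<comment> \<open>The prism operator applied to \<open>c\<close>, normalised like every
      cochain.\<close>
    define K where "K = (\<lambda>\<tau>. if singular_simplex r X \<tau> then \<Sum>i\<le>r. c (prism r h i \<tau>) else 0)"
    have "b = coboundary r X K"
    proof
      fix \<sigma> show "b \<sigma> = coboundary r X K \<sigma>"
      proof (cases "singular_simplex p X \<sigma>")
        case True
        then have "singular_simplex r X (singular_face (Suc r) k \<sigma>)" if "k \<le> Suc r" for k
          using singular_simplex_singular_face[OF True _ that[folded Suc]] Suc by simp
        then show ?thesis
          using b[OF True] True
          by (simp add: Suc coboundary_def K_def lessThan_Suc_atMost del: sum.atMost_Suc)
      qed (simp add: b_def cochain_pullback_def coboundary_def Suc)
    qed
    then show ?thesis
      unfolding Suc coboundaries_def by (auto simp: K_def cochain_group_def)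
  qed
  moreover have "cochain_pullback p X g c = (\<lambda>\<sigma>. b \<sigma> + cochain_pullback p X f c \<sigma>)"
  proof
    fix \<sigma> show "cochain_pullback p X g c \<sigma> = b \<sigma> + cochain_pullback p X f c \<sigma>"
      by (cases "cochain_pullback p X f c \<sigma>") (auto simp: b_def add.assoc)
  qed
  ultimately show ?thesis
    by (simp add: c(2) fg cohomology_pullback_class cohomology_class_add_coboundary)
qed

theorem cohomology_pullback_homotopy_equivalence:
  assumes f: "continuous_map X Y f" and g: "continuous_map Y X g"
    and gf: "homotopic_with (\<lambda>_. True) X X (g \<circ> f) id"
    and fg: "homotopic_with (\<lambda>_. True) Y Y (f \<circ> g) id"
  shows "cohomology_pullback p X f \<in> iso (cohomology_group p Y) (cohomology_group p X)"
proof -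
  have "bij_betw (cohomology_pullback p X f) (carrier (cohomology_group p Y)) (carrier (cohomology_group p X))"
  proof (rule bij_betw_byWitness[where f' = "cohomology_pullback p Y g"])
    show "\<forall>a\<in>carrier (cohomology_group p Y). cohomology_pullback p Y g (cohomology_pullback p X f a) = a"
      using cohomology_pullback_homotopic[OF fg]
      by (simp add: cohomology_pullback_compose[OF g] cohomology_pullback_id)
    show "\<forall>a\<in>carrier (cohomology_group p X). cohomology_pullback p X f (cohomology_pullback p Y g a) = a"
      using cohomology_pullback_homotopic[OF gf]
      by (simp add: cohomology_pullback_compose[OF f] cohomology_pullback_id)
  qed (use hom_carrier[OF cohomology_pullback_hom[OF f]] hom_carrier[OF cohomology_pullback_hom[OF g]] in auto)
  then show ?thesis
    using cohomology_pullback_hom[OF f] by (simp add: iso_def)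
qed

section \<open>Nearest-point projections below the reach\<close>

lemma dist_closest_point_eq_infdist:
  assumes "closed S" "S \<noteq> {}"
  shows "dist x (closest_point S x) = infdist x S"
proof (rule antisym)
  show "dist x (closest_point S x) \<le> infdist x S"
    using assms by (auto simp: infdist_def intro!: cINF_greatest closest_point_le)
qed (use assms closest_point_in_set infdist_le in blast)

text \<open>For the ordinary metric, the uniqueness clause on \<open>r\<close> in the definition of
  \<open>reach\<close>; \<open>scale_matrix\<close> reduces the weighted norm to this case.\<close>

definition unique_nearest :: "real \<Rightarrow> 'a::metric_space set \<Rightarrow> bool" where
  "unique_nearest r M \<longleftrightarrow>
     (\<forall>x. infdist x M < r \<longrightarrow> (\<exists>!p. p \<in> M \<and> (\<forall>y\<in>M. dist x p \<le> dist x y)))"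

lemma unique_nearest_eq_closest_point:
  assumes "unique_nearest r M" "closed M" "infdist x M < r" "p \<in> M" "dist x p \<le> infdist x M"
  shows "p = closest_point M x"
proof -
  have "M \<noteq> {}" using assms by auto
  then have "closest_point M x \<in> M \<and> (\<forall>y\<in>M. dist x (closest_point M x) \<le> dist x y)"
    using assms(2) closest_point_exists by blast
  moreover have "\<forall>y\<in>M. dist x p \<le> dist x y"
    using assms(5) infdist_le order_trans by blast
  ultimately show ?thesis
    using assms unfolding unique_nearest_def by blast
qed

text \<open>A map into a compact set is continuous if its graph is closed. By uniqueness the graph
  is the closed set on which \<open>dist x p\<close> equals \<open>infdist x M\<close>.\<close>

lemma continuous_on_closest_point_unique:
  fixes M :: "'a::euclidean_space set"
  assumes M: "compact M" "M \<noteq> {}" and un: "unique_nearest r M"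
  shows "continuous_on {x. infdist x M < r} (closest_point M)"
proof -
  let ?U = "{x. infdist x M < r}"
  have cl: "closed M" using M compact_imp_closed by auto
  have into: "closest_point M \<in> ?U \<rightarrow> M"
    using cl M by (auto intro: closest_point_in_set)
  have "(\<lambda>x. (x, closest_point M x)) ` ?U =
    {z \<in> ?U \<times> M. dist (fst z) (snd z) - infdist (fst z) M = 0}"
    using unique_nearest_eq_closest_point[OF un cl] dist_closest_point_eq_infdist[OF cl M(2)]
      closest_point_in_set[OF cl M(2)]
    by (auto simp: image_iff)
  moreover have "closedin (top_of_set (?U \<times> M)) {z \<in> ?U \<times> M. dist (fst z) (snd z) - infdist (fst z) M = 0}"
    by (intro continuous_closedin_preimage_constant continuous_intros)
  ultimately show ?thesis
    by (simp add: continuous_closed_graph_eq[OF M(1) into])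
qed

text \<open>Moving from \<open>y\<close> straight away from its nearest point increases the distance
  to \<open>M\<close> at a rate near 1: the nearest point of the moved point varies continuously, so
  the direction of motion still points almost straight away from it.\<close>

lemma infdist_increase_locally:
  fixes M :: "'a::euclidean_space set"
  assumes M: "compact M" "M \<noteq> {}" and un: "unique_nearest r M"
    and y: "0 < infdist y M" "infdist y M < r" and c: "c < 1" and \<delta>: "0 < \<delta>"
  obtains z where "dist y z < \<delta>" "infdist z M > infdist y M + c * dist y z"
proof -
  have cl: "closed M" using M compact_imp_closed by auto
  let ?U = "{x. infdist x M < r}"
  define q0 where "q0 = closest_point M y"
  define v where "v = (1 / infdist y M) *\<^sub>R (y - q0)"
  \<comment> \<open>\<open>F w > 0\<close> says that the cosine of the angle between
    \<open>v\<close> and \<open>y - w\<close> exceeds \<open>c\<close>, which holds at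
    \<open>q0\<close> and so at nearby points.\<close>
  define F where "F w = v \<bullet> (y - w) - c * norm (y - w)" for w
  define z where "z \<eta> = y + \<eta> *\<^sub>R v" for \<eta> :: real
  have nq0: "norm (y - q0) = infdist y M"
    using dist_closest_point_eq_infdist[OF cl M(2)] by (simp add: q0_def dist_norm)
  have v: "norm v = 1"
    using y by (simp add: v_def nq0)
  have "v \<bullet> (y - q0) = infdist y M"
    using y by (simp add: v_def nq0 dot_square_norm power2_eq_square)
  then have F0: "F q0 > 0"
    using c y by (simp add: F_def nq0)
  have "open ?U"
    by (intro open_Collect_less continuous_intros)
  then have "isCont (closest_point M) y"
    using continuous_on_closest_point_unique[OF M un] y by (simp add: continuous_on_eq_continuous_at)
  moreover have "(z \<longlongrightarrow> y) (at_right 0)"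
    unfolding z_def by (auto intro!: tendsto_eq_intros)
  ultimately have "((\<lambda>\<eta>. closest_point M (z \<eta>)) \<longlongrightarrow> q0) (at_right 0)"
    unfolding q0_def by (rule isCont_tendsto_compose)
  then have "((\<lambda>\<eta>. F (closest_point M (z \<eta>))) \<longlongrightarrow> F q0) (at_right 0)"
    unfolding F_def by (intro tendsto_intros)
  then have "\<forall>\<^sub>F \<eta> in at_right 0. F (closest_point M (z \<eta>)) > 0"
    using F0 by (simp add: order_tendstoD)
  moreover have "\<forall>\<^sub>F \<eta> in at_right 0. \<eta> < \<delta>"
    using \<delta> eventually_at_right_field by blast
  moreover have "\<forall>\<^sub>F \<eta> in at_right 0. 0 < (\<eta>::real)"
    by (simp add: eventually_at_right_less)
  ultimately have "\<forall>\<^sub>F \<eta> in at_right 0. F (closest_point M (z \<eta>)) > 0 \<and> \<eta> < \<delta> \<and> 0 < \<eta>"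
    by eventually_elim auto
  then obtain \<eta> where \<eta>: "F (closest_point M (z \<eta>)) > 0" "\<eta> < \<delta>" "0 < \<eta>"
    using eventually_happens'[OF trivial_limit_at_right_real] by blast
  define q where "q = closest_point M (z \<eta>)"
  have q: "infdist (z \<eta>) M = norm (z \<eta> - q)" "infdist y M \<le> norm (y - q)"
    using dist_closest_point_eq_infdist[OF cl M(2), of "z \<eta>"] infdist_le[of q M y]
      closest_point_in_set[OF cl M(2)] by (auto simp: q_def dist_norm)
  have dz: "dist y (z \<eta>) = \<eta>"
    using v \<eta> by (simp add: z_def dist_norm)
  have "z \<eta> - q = (y - q) + \<eta> *\<^sub>R v"
    by (simp add: z_def)
  \<comment> \<open>Pairing with \<open>y - q\<close> and dividing by its norm bounds the new
    distance from below.\<close>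
  then have "norm (y - q) * norm (y - q) + \<eta> * (v \<bullet> (y - q)) = (z \<eta> - q) \<bullet> (y - q)"
    by (simp only: inner_add_left inner_scaleR_left dot_square_norm power2_eq_square)
  also have "\<dots> \<le> norm (z \<eta> - q) * norm (y - q)"
    by (rule norm_cauchy_schwarz)
  finally have "norm (y - q) * norm (y - q) + \<eta> * (v \<bullet> (y - q)) \<le> norm (z \<eta> - q) * norm (y - q)" .
  moreover have "\<eta> * (c * norm (y - q)) < \<eta> * (v \<bullet> (y - q))"
    using \<eta> by (simp add: F_def q_def)
  ultimately have "(norm (y - q) + \<eta> * c) * norm (y - q) < norm (z \<eta> - q) * norm (y - q)"
    by (simp add: algebra_simps)
  then have "norm (y - q) + \<eta> * c < norm (z \<eta> - q)"
    using mult_less_cancel_right_pos q(2) y(1) by (metis linorder_not_le order_less_le_trans)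
  then have "infdist (z \<eta>) M > infdist y M + c * dist y (z \<eta>)"
    using q by (simp add: dz mult.commute)
  then show ?thesis
    using that[of "z \<eta>"] dz \<eta> by simp
qed

text \<open>
  For \<open>c < 1\<close>, a maximiser of \<open>y \<mapsto> d(y, M) - c |x - y|\<close> on the ball lies on its boundary by
  \<open>infdist_increase_locally\<close>; letting \<open>c\<close> tend to 1 gives a point at which the triangle
  inequality is an equality.
\<close>

lemma infdist_along_normal:
  fixes M :: "'a::euclidean_space set"
  assumes M: "compact M" "M \<noteq> {}" and un: "unique_nearest r M"
    and x: "0 < infdist x M" and h: "0 \<le> h" "infdist x M + h < r"
  shows "infdist (x + (h / infdist x M) *\<^sub>R (x - closest_point M x)) M = infdist x M + h"
proof -
  have cl: "closed M" using M compact_imp_closed by auto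
  have ne: "cball x h \<noteq> {}" using h by auto
  have cont: "continuous_on (cball x h) (\<lambda>y. infdist y M)"
    by (intro continuous_intros)
  \<comment> \<open>Unlike \<open>w\<close> below, this maximiser does not depend on
    \<open>c\<close>, so \<open>c\<close> can tend to 1 with \<open>y\<close> fixed.\<close>
  have "\<exists>y\<in>cball x h. \<forall>y'\<in>cball x h. infdist y' M \<le> infdist y M"
    using continuous_attains_sup[OF compact_cball ne cont] by blast
  then obtain y where y: "dist x y \<le> h" and ymax: "\<And>y'. dist x y' \<le> h \<Longrightarrow> infdist y' M \<le> infdist y M"
    by auto
  have "c * h \<le> infdist y M - infdist x M" if c: "0 < c" "c < 1" for c
  proof -
    have "continuous_on (cball x h) (\<lambda>y. infdist y M - c * dist x y)"
      by (intro continuous_intros)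
    then obtain w where w: "dist x w \<le> h"
      and wmax: "\<And>w'. dist x w' \<le> h \<Longrightarrow> infdist w' M - c * dist x w' \<le> infdist w M - c * dist x w"
      using continuous_attains_sup[OF compact_cball ne] by (metis (no_types, lifting) mem_cball)
    have wx: "infdist x M + c * dist x w \<le> infdist w M"
      using wmax[of x] h by simp
    have "dist x w = h"
    proof (rule ccontr)
      assume "dist x w \<noteq> h"
      then have lt: "0 < h - dist x w" using w by simp
      have "infdist w M \<le> infdist x M + dist x w"
        using infdist_triangle[of w M x] by (simp add: dist_commute)
      then have "infdist w M < r" using h w by simp
      moreover have "0 < infdist w M"
        using wx x c by (smt (verit) mult_nonneg_nonneg zero_le_dist)
      ultimately obtain z where z: "dist w z < h - dist x w" "infdist z M > infdist w M + c * dist w z"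
        using infdist_increase_locally[OF M un _ _ c(2) lt] by blast
      have tri: "dist x z \<le> dist x w + dist w z" by (rule dist_triangle)
      then have "c * dist x z \<le> c * dist x w + c * dist w z"
        using c by (simp flip: distrib_left)
      then show False
        using wmax[of z] z tri by linarith
    qed
    then show ?thesis
      using wx ymax[OF w] by simp
  qed
  then have ge: "infdist x M + h \<le> infdist y M"
    using field_le_mult_one_interval[of h "infdist y M - infdist x M"] by simp
  define p where "p = closest_point M x"
  have p: "p \<in> M" "dist x p = infdist x M"
    using cl M dist_closest_point_eq_infdist by (auto simp: p_def closest_point_in_set)
  have "infdist y M \<le> dist y p" using p infdist_le by blast
  moreover have "dist y p \<le> dist x y + dist x p"
    by (metis dist_commute dist_triangle)
  ultimately have eqs: "dist y p = h + dist x p" "dist x y = h" "infdist y M = infdist x M + h"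
    using ge y p by auto
  \<comment> \<open>Equality in the triangle inequality makes the two vectors parallel, which puts
    \<open>y\<close> on the normal ray.\<close>
  have "norm ((x - p) + (y - x)) = norm (x - p) + norm (y - x)"
    using eqs by (simp add: dist_norm norm_minus_commute)
  then have "dist x p *\<^sub>R (y - x) = h *\<^sub>R (x - p)"
    using eqs(2) norm_triangle_eq[of "x - p" "y - x"] by (simp add: dist_norm norm_minus_commute)
  then have "y - x = (h / infdist x M) *\<^sub>R (x - p)"
    using x p by (simp add: divide_inverse_commute flip: scaleR_scaleR)
       (metis (no_types) inverse_eq_divide less_irrefl real_vector_affinity_eq scaleR_one scaleR_scaleR left_inverse)
  then have "x + (h / infdist x M) *\<^sub>R (x - p) = y" by (simp add: algebra_simps)
  then show ?thesis
    using eqs by (simp add: p_def)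
qed

lemma power2_norm_scaleR_diff:
  fixes v w :: "'a::real_inner"
  shows "(norm (a *\<^sub>R v - w))\<^sup>2 = a\<^sup>2 * (norm v)\<^sup>2 - 2 * a * (v \<bullet> w) + (norm w)\<^sup>2"
  unfolding power2_norm_eq_inner
  by (simp add: inner_diff_left inner_diff_right inner_commute power2_eq_square algebra_simps)

text \<open>Federer, \<^emph>\<open>Curvature measures\<close>, Theorem 4.8(7).\<close>

lemma federer_inequality:
  fixes M :: "'a::euclidean_space set"
  assumes M: "compact M" and un: "unique_nearest r M"
    and x: "infdist x M \<le> R" "R < r" and q: "q \<in> M"
  defines "p \<equiv> closest_point M x"
  shows "2 * R * ((x - p) \<bullet> (q - p)) \<le> dist x p * (norm (q - p))\<^sup>2"
proof (cases "x = p")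
  case False
  have ne: "M \<noteq> {}" using q by auto
  have cl: "closed M" using M compact_imp_closed by auto
  define s where "s = infdist x M"
  have s: "dist x p = s" "norm (x - p) = s"
    using dist_closest_point_eq_infdist[OF cl ne, of x] by (simp_all add: p_def s_def dist_norm)
  have s0: "s > 0" using False s by force
  \<comment> \<open>The point at distance \<open>R\<close> from \<open>p\<close> on the ray through
    \<open>x\<close>. It has distance \<open>R\<close> from \<open>M\<close> too, so
    \<open>q\<close> is at least that far away; expanding the square gives the claim.\<close>
  define y where "y = x + ((R - s) / s) *\<^sub>R (x - p)"
  have "infdist y M = R"
    using infdist_along_normal[OF M ne un, of x "R - s"] s0 x by (simp add: y_def p_def s_def)
  then have "R \<le> norm (y - q)"
    using infdist_le[OF q, of y] by (simp add: dist_norm)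
  moreover have "0 \<le> R" using s0 x s_def by linarith
  ultimately have "R\<^sup>2 \<le> (norm (y - q))\<^sup>2" by (rule power_mono)
  also have "y - q = (R / s) *\<^sub>R (x - p) - (q - p)"
    using s0 by (simp add: y_def diff_divide_distrib algebra_simps)
  also have "(norm \<dots>)\<^sup>2 = (R / s)\<^sup>2 * (norm (x - p))\<^sup>2 - 2 * (R / s) * ((x - p) \<bullet> (q - p)) + (norm (q - p))\<^sup>2"
    by (rule power2_norm_scaleR_diff)
  also have "(R / s)\<^sup>2 * (norm (x - p))\<^sup>2 = R\<^sup>2"
    using s s0 by (simp add: power_divide)
  finally have "2 * (R / s) * ((x - p) \<bullet> (q - p)) \<le> (norm (q - p))\<^sup>2" by simp
  then have "s * (2 * (R / s) * ((x - p) \<bullet> (q - p))) \<le> s * (norm (q - p))\<^sup>2"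
    using s0 by (intro mult_left_mono) auto
  then show ?thesis using s0 s by (simp add: field_simps)
qed simp

text \<open>
  On the part of the segment within \<open>t - e\<close> of \<open>M\<close> the point of \<open>K\<close> near the projection
  serves; the rest lies in the ball of radius \<open>t\<close> about the point of \<open>K\<close> near \<open>x\<close>, by
  \<open>federer_inequality\<close> and convexity of the ball. The condition \<open>4 e \<le> t\<close> is what makes the two
  parts meet.
\<close>

lemma segment_to_projection_in_offset:
  fixes M K :: "'a::euclidean_space set"
  assumes M: "compact M" and un: "unique_nearest r M"
    and KM: "\<And>q. q \<in> K \<Longrightarrow> \<exists>m\<in>M. dist q m \<le> e" and MK: "\<And>m. m \<in> M \<Longrightarrow> \<exists>q\<in>K. dist m q \<le> e"
    and e: "0 \<le> e" "4 * e \<le> t" "t + 3 * e < r"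
    and x: "q \<in> K" "dist x q \<le> t"
    and y: "y \<in> closed_segment x (closest_point M x)"
  shows "\<exists>q\<in>K. dist y q \<le> t"
proof -
  define p where "p = closest_point M x"
  obtain m where m: "m \<in> M" "dist q m \<le> e" using KM x by blast
  have cl: "closed M" and ne: "M \<noteq> {}" using M compact_imp_closed m by auto
  have pM: "p \<in> M" using cl ne by (simp add: p_def closest_point_in_set)
  then obtain q' where q': "q' \<in> K" "dist p q' \<le> e" using MK by blast
  define s where "s = dist x p"
  have s: "s = infdist x M" "norm (x - p) = s"
    using dist_closest_point_eq_infdist[OF cl ne, of x] by (simp_all add: s_def p_def dist_norm)
  have xm: "dist x m \<le> t + e" using x m dist_triangle[of x m q] by linarith
  have s_le: "s \<le> t + e" using s infdist_le[OF m(1), of x] xm by linarith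
  obtain l where l: "0 \<le> l" "l \<le> 1" "y = p + l *\<^sub>R (x - p)"
  proof -
    obtain l' where "0 \<le> l'" "l' \<le> 1" "y = (1 - l') *\<^sub>R x + l' *\<^sub>R p"
      using y by (auto simp: in_segment p_def)
    then show thesis by (intro that[of "1 - l'"]) (auto simp: algebra_simps)
  qed
  show ?thesis
  proof (cases "l * s \<le> t - e")
    case True
    have "dist y p = l * s" using l s by (simp add: dist_norm)
    then have "dist y q' \<le> t" using dist_triangle[of y q' p] q' True by linarith
    then show ?thesis using q' by blast
  next
    case False
    define a where "a = t - e"
    have a0: "0 \<le> a" using e by (simp add: a_def)
    have "l * s \<le> s" using l s_def by (simp add: mult_left_le_one_le)
    then have as: "a < s" using False by (simp add: a_def)
    \<comment> \<open>With \<open>e = 0\<close> the first case would cover the whole segment.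
      Positivity of \<open>e\<close> makes \<open>t + 3 * e - s\<close> positive, so that it can be
      divided out below.\<close>
    then have e0: "0 < e" using s_le a_def by linarith
    have s0: "0 < s" using as a0 by linarith
    define v where "v = x - p"
    define w where "w = m - p"
    define k where "k = v \<bullet> w"
    have nv: "norm v = s" using s by (simp add: v_def)
    have R: "0 < t + 3 * e - s" using s_le e0 by linarith
    have fed: "2 * (t + 3 * e) * k \<le> s * (norm w)\<^sup>2"
      using federer_inequality[OF M un _ e(3) m(1), of x] s_le s e0
      by (simp add: k_def v_def w_def p_def s_def)
    have "norm (1 *\<^sub>R v - w) \<le> t + e"
      using xm by (simp add: v_def w_def dist_norm)
    then have "(norm (1 *\<^sub>R v - w))\<^sup>2 \<le> (t + e)\<^sup>2"
      by (rule power_mono) simp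
    then have "s\<^sup>2 - 2 * k + (norm w)\<^sup>2 \<le> (t + e)\<^sup>2"
      unfolding power2_norm_scaleR_diff by (simp add: nv k_def)
    then have "s * (s\<^sup>2 - 2 * k + (norm w)\<^sup>2) \<le> s * (t + e)\<^sup>2"
      using s0 by (intro mult_left_mono) auto
    \<comment> \<open>Eliminates \<open>norm w\<close> between Federer's inequality and the bound on
      the distance from \<open>x\<close> to \<open>m\<close>.\<close>
    then have "2 * k * (t + 3 * e - s) \<le> s * ((t + e)\<^sup>2 - s\<^sup>2)"
      using fed by (simp add: algebra_simps)
    also have "(t + e)\<^sup>2 - s\<^sup>2 \<le> (t + 3 * e - s) * (s + t - 3 * e)"
    proof -
      \<comment> \<open>The right side minus the left side; \<open>4 * e \<le> t\<close> and
        \<open>t - e < s\<close> make both summands nonnegative.\<close>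
      have "0 \<le> e * (4 * (t - 4 * e) + 6 * (s - (t - e)))"
        using e0 e as by (intro mult_nonneg_nonneg) (auto simp: a_def)
      then show ?thesis by (simp add: algebra_simps power2_eq_square)
    qed
    finally have "2 * k * (t + 3 * e - s) \<le> (s * (s + t - 3 * e)) * (t + 3 * e - s)"
      using s0 by (simp add: mult_left_mono mult_ac)
    then have k: "2 * k \<le> s * (s + t - 3 * e)"
      using R by (simp add: mult_right_le_imp_le)
    \<comment> \<open>Chosen so that \<open>x - \<theta> *\<^sub>R v\<close> is the point of the
      segment at distance \<open>t - e\<close> from \<open>p\<close>, where the first case
      ends.\<close>
    define \<theta> where "\<theta> = 1 - a / s"
    have \<theta>: "0 \<le> \<theta>" "\<theta> * s = s - a" using as s0 by (auto simp: \<theta>_def field_simps)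
    have "v \<bullet> (q - m) \<le> norm v * norm (q - m)" by (rule norm_cauchy_schwarz)
    also have "\<dots> \<le> s * e" using m nv s0 by (simp add: dist_norm mult_left_mono)
    finally have vz: "v \<bullet> (q - m) \<le> s * e" .
    have "v \<bullet> (x - q) = v \<bullet> v - k - v \<bullet> (q - m)"
      by (simp add: v_def w_def k_def inner_diff_right)
    \<comment> \<open>As \<open>\<theta> * s = s - a\<close>, this is the condition for
      \<open>x - \<theta> *\<^sub>R v\<close> to be no farther from \<open>q\<close> than
      \<open>x\<close> is.\<close>
    then have "2 * (v \<bullet> (x - q)) \<ge> s * (s - a)"
      using vz k nv by (simp add: dot_square_norm a_def algebra_simps power2_eq_square)
    then have "2 * (v \<bullet> (x - q)) \<ge> \<theta> * s\<^sup>2"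
      unfolding \<theta>(2)[symmetric] by (simp add: power2_eq_square mult_ac)
    then have "\<theta> * (2 * (v \<bullet> (x - q))) \<ge> \<theta> * (\<theta> * s\<^sup>2)"
      using \<theta> by (intro mult_left_mono)
    then have "(norm (\<theta> *\<^sub>R v - (x - q)))\<^sup>2 \<le> (norm (x - q))\<^sup>2"
      unfolding power2_norm_scaleR_diff by (simp add: nv power2_eq_square mult_ac)
    then have "norm (\<theta> *\<^sub>R v - (x - q)) \<le> norm (x - q)"
      by (rule power2_le_imp_le) simp
    then have y0: "dist (x - \<theta> *\<^sub>R v) q \<le> t"
      using x by (simp add: dist_norm norm_minus_commute algebra_simps)
    have "y \<in> closed_segment (x - \<theta> *\<^sub>R v) x"
    proof -
      define \<mu> where "\<mu> = (1 - l) / \<theta>"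
      have "0 < \<theta>" using as s0 by (simp add: \<theta>_def)
      moreover have "1 - l \<le> \<theta>"
        using False s0 by (simp add: \<theta>_def a_def field_simps)
      ultimately have \<mu>: "0 \<le> \<mu>" "\<mu> \<le> 1" "\<mu> * \<theta> = 1 - l"
        using l by (auto simp: \<mu>_def)
      have "y = x - (1 - l) *\<^sub>R v" using l by (simp add: v_def algebra_simps)
      then have "y = (1 - (1 - \<mu>)) *\<^sub>R (x - \<theta> *\<^sub>R v) + (1 - \<mu>) *\<^sub>R x"
        unfolding \<mu>(3)[symmetric] by (simp add: algebra_simps)
      then show ?thesis
        using \<mu> unfolding in_segment by (intro exI[of _ "1 - \<mu>"]) auto
    qed
    moreover have "closed_segment (x - \<theta> *\<^sub>R v) x \<subseteq> cball q t"
      using y0 x by (intro closed_segment_subset convex_cball) (auto simp: dist_commute)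
    ultimately have "dist y q \<le> t" by (auto simp: dist_commute)
    then show ?thesis using x by blast
  qed
qed

text \<open>The distance to \<open>X\<close> need not be attained in \<open>X\<close>, but it is
  attained in the closure, which has the same offsets.\<close>

lemma infdist_le_iff_closure:
  fixes X :: "'a::heine_borel set"
  assumes "X \<noteq> {}"
  shows "infdist x X \<le> t \<longleftrightarrow> (\<exists>q\<in>closure X. dist x q \<le> t)"
proof -
  have "infdist x X = infdist x (closure X)"
    by (simp add: infdist_eq_setdist)
  moreover obtain q where "q \<in> closure X" "infdist x (closure X) = dist x q"
    using infdist_attains_inf[of "closure X"] assms by auto
  ultimately show ?thesis
    using infdist_le order_trans by metis
qed

text \<open>\<open>segment_to_projection_in_offset\<close> is applied to the closure of
  \<open>X\<close>. The bound on the distance to \<open>M\<close> passes to the closure by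
  continuity.\<close>

lemma offset_retraction:
  fixes M X :: "'a::euclidean_space set"
  assumes M: "compact M" "M \<noteq> {}" and X: "X \<noteq> {}" and un: "unique_nearest r M"
    and XM: "\<And>x. x \<in> X \<Longrightarrow> infdist x M \<le> e" and MX: "\<And>m. m \<in> M \<Longrightarrow> infdist m X \<le> e"
    and e: "0 \<le> e" "4 * e \<le> t" "t + 3 * e < r"
  shows "continuous_on {x. infdist x X \<le> t} (closest_point M)"
    and "M \<subseteq> {x. infdist x X \<le> t}"
    and "\<And>x. infdist x X \<le> t \<Longrightarrow> closed_segment x (closest_point M x) \<subseteq> {x. infdist x X \<le> t}"
proof -
  have cl: "closed M" using M compact_imp_closed by auto
  have XM': "\<exists>m\<in>M. dist q m \<le> e" if "q \<in> closure X" for q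
  proof -
    have "closed {q. infdist q M \<le> e}"
      by (intro closed_Collect_le continuous_intros)
    then have "infdist q M \<le> e"
      using closure_minimal[of X "{q. infdist q M \<le> e}"] XM that by auto
    then show ?thesis
      using dist_closest_point_eq_infdist[OF cl M(2), of q] closest_point_in_set[OF cl M(2), of q]
      by (intro bexI[of _ "closest_point M q"]) simp_all
  qed
  have MX': "\<exists>q\<in>closure X. dist m q \<le> e" if "m \<in> M" for m
    using MX[OF that] infdist_le_iff_closure[OF X] by blast
  have "infdist x M < r" if x: "infdist x X \<le> t" for x
  proof -
    obtain q where q: "q \<in> closure X" "dist x q \<le> t"
      using x infdist_le_iff_closure[OF X] by blast
    then obtain m where "m \<in> M" "dist q m \<le> e" using XM' by blast
    then have "infdist x M \<le> t + e"
      using infdist_le[of m M x] dist_triangle[of x m q] q by linarith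
    then show ?thesis using e by linarith
  qed
  then show "continuous_on {x. infdist x X \<le> t} (closest_point M)"
    by (intro continuous_on_subset[OF continuous_on_closest_point_unique[OF M un]]) auto
  show "M \<subseteq> {x. infdist x X \<le> t}"
    using MX e by force
  show "closed_segment x (closest_point M x) \<subseteq> {x. infdist x X \<le> t}" if "infdist x X \<le> t" for x
    using segment_to_projection_in_offset[OF M(1) un XM' MX' e] that
    unfolding infdist_le_iff_closure[OF X] by blast
qed

section \<open>The weighted norm\<close>

text \<open>Carries the weighted norm to the norm of the product type, for which nearest points are
  studied above.\<close>

definition scale_matrix :: "real \<Rightarrow> (real^'n) \<times> (real^'m^'m) \<Rightarrow> (real^'n) \<times> (real^'m^'m)" where
  "scale_matrix \<gamma> e = (fst e, \<gamma> *\<^sub>R snd e)"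

lemma linear_scale_matrix: "linear (scale_matrix \<gamma>)"
  by (intro linearI) (auto simp: scale_matrix_def algebra_simps)

lemma scale_matrix_inverse:
  assumes "\<gamma> > 0"
  shows "scale_matrix (1 / \<gamma>) (scale_matrix \<gamma> e) = e" "scale_matrix \<gamma> (scale_matrix (1 / \<gamma>) e) = e"
  using assms by (simp_all add: scale_matrix_def)

lemma scale_matrix_eq_iff:
  assumes "\<gamma> > 0"
  shows "scale_matrix \<gamma> e = scale_matrix \<gamma> e' \<longleftrightarrow> e = e'"
  using scale_matrix_inverse[OF assms] by metis

lemma gnorm_diff_eq_dist: "gnorm \<gamma> (e - e') = dist (scale_matrix \<gamma> e) (scale_matrix \<gamma> e')"
  by (simp add: gnorm_def scale_matrix_def dist_norm norm_prod_def power_mult_distrib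
      flip: scaleR_diff_right)

text \<open>Over the empty set the extended infimum is infinite while \<open>infdist\<close> is 0,
  whence the assumption.\<close>

lemma gsetdist_eq_infdist:
  assumes "X \<noteq> {}"
  shows "gsetdist \<gamma> e X = ereal (infdist (scale_matrix \<gamma> e) (scale_matrix \<gamma> ` X))"
proof -
  have "bdd_below ((\<lambda>x. dist (scale_matrix \<gamma> e) (scale_matrix \<gamma> x)) ` X)"
    by (rule bdd_belowI2[of _ 0]) simp
  then have "ereal (INF x\<in>X. dist (scale_matrix \<gamma> e) (scale_matrix \<gamma> x)) =
      (INF x\<in>X. ereal (dist (scale_matrix \<gamma> e) (scale_matrix \<gamma> x)))"
    using assms by (subst ereal_Inf') (auto simp: image_image)
  then show ?thesis
    using assms by (simp add: gsetdist_def gnorm_diff_eq_dist infdist_def image_image)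
qed

lemma unique_nearest_scale_matrix:
  assumes \<gamma>: "\<gamma> > 0" and M: "M \<noteq> {}"
    and un: "\<And>e. gsetdist \<gamma> e M < ereal r \<Longrightarrow>
      \<exists>!x. x \<in> M \<and> (\<forall>y\<in>M. gnorm \<gamma> (e - x) \<le> gnorm \<gamma> (e - y))"
  shows "unique_nearest r (scale_matrix \<gamma> ` M)"
  unfolding unique_nearest_def
proof (intro allI impI)
  fix z assume z: "infdist z (scale_matrix \<gamma> ` M) < r"
  obtain e where e: "z = scale_matrix \<gamma> e"
    using scale_matrix_inverse(2)[OF \<gamma>] by metis
  then have "gsetdist \<gamma> e M < ereal r"
    using z M by (simp add: gsetdist_eq_infdist)
  then obtain x where x: "x \<in> M" "\<And>y. y \<in> M \<Longrightarrow> dist z (scale_matrix \<gamma> x) \<le> dist z (scale_matrix \<gamma> y)"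
    and uniq: "\<And>x'. x' \<in> M \<Longrightarrow> \<forall>y\<in>M. dist z (scale_matrix \<gamma> x') \<le> dist z (scale_matrix \<gamma> y) \<Longrightarrow> x' = x"
    using un[of e] unfolding gnorm_diff_eq_dist e by metis
  show "\<exists>!p. p \<in> scale_matrix \<gamma> ` M \<and> (\<forall>y\<in>scale_matrix \<gamma> ` M. dist z p \<le> dist z y)"
  proof (rule ex1I[of _ "scale_matrix \<gamma> x"])
    fix p assume "p \<in> scale_matrix \<gamma> ` M \<and> (\<forall>y\<in>scale_matrix \<gamma> ` M. dist z p \<le> dist z y)"
    then show "p = scale_matrix \<gamma> x"
      using uniq by blast
  qed (use x in blast)
qed

text \<open>The strict gap between \<open>R\<close> and \<open>r\<close> lets points be pushed out
  to distance \<open>R\<close> while nearest points stay unique.\<close>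

lemma reach_greater_imp_unique_nearest:
  assumes "\<gamma> > 0" "M \<noteq> {}" "ereal R < reach \<gamma> M"
  obtains r where "R < r" "unique_nearest r (scale_matrix \<gamma> ` M)"
proof -
  obtain r where r: "ereal R < ereal r" and un: "\<And>e. gsetdist \<gamma> e M < ereal r \<Longrightarrow>
      \<exists>!x. x \<in> M \<and> (\<forall>y\<in>M. gnorm \<gamma> (e - x) \<le> gnorm \<gamma> (e - y))"
    using assms(3) unfolding reach_def less_Sup_iff by blast
  show thesis
    using that r unique_nearest_scale_matrix[OF assms(1,2) un] by simp
qed

theorem offset_homotopy_equivalence:
  fixes M X :: "((real^'n) \<times> (real^'m^'m)) set"
  assumes \<gamma>: "\<gamma> > 0" and M: "compact M" "M \<noteq> {}" and X: "X \<noteq> {}"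
    and t: "4 * hausdorff_distance \<gamma> X M \<le> ereal t"
      "ereal t < reach \<gamma> M - 3 * hausdorff_distance \<gamma> X M"
  obtains \<pi> where "continuous_map (top_of_set (offset \<gamma> X t)) (top_of_set M) \<pi>"
    and "M \<subseteq> offset \<gamma> X t" and "\<And>x. x \<in> M \<Longrightarrow> \<pi> x = x"
    and "homotopic_with (\<lambda>_. True) (top_of_set (offset \<gamma> X t)) (top_of_set (offset \<gamma> X t)) \<pi> id"
proof -
  let ?S = "scale_matrix \<gamma>" and ?S' = "scale_matrix (1 / \<gamma>)"
  define \<epsilon> where "\<epsilon> = hausdorff_distance \<gamma> X M"
  have le: "gsetdist \<gamma> x M \<le> \<epsilon>" if "x \<in> X" for x
    using that by (auto simp: \<epsilon>_def hausdorff_distance_def intro: max.coboundedI1 SUP_upper)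
  have le': "gsetdist \<gamma> m X \<le> \<epsilon>" if "m \<in> M" for m
    using that by (auto simp: \<epsilon>_def hausdorff_distance_def intro: max.coboundedI2 SUP_upper)
  obtain x where "x \<in> X" using X by blast
  with le[of x] M have "0 \<le> \<epsilon>"
    by (simp add: gsetdist_eq_infdist infdist_nonneg order_trans[rotated])
  \<comment> \<open>An infinite distance would contradict \<open>4 * \<epsilon> \<le> t\<close> with
    \<open>t\<close> real.\<close>
  moreover have "\<epsilon> \<noteq> \<infinity>"
    using t by (auto simp flip: \<epsilon>_def)
  ultimately obtain e where e: "\<epsilon> = ereal e" "0 \<le> e"
    by (cases \<epsilon>) auto
  \<comment> \<open>The reach may be infinite, hence the case distinction.\<close>
  have "ereal (t + 3 * e) < reach \<gamma> M"
    using t(2) e by (cases "reach \<gamma> M") (auto simp flip: \<epsilon>_def)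
  then obtain r where r: "t + 3 * e < r" "unique_nearest r (?S ` M)"
    using reach_greater_imp_unique_nearest \<gamma> M by metis
  have te: "4 * e \<le> t"
    using t(1) e by (simp flip: \<epsilon>_def)
  have offset: "offset \<gamma> X t = {z. infdist (?S z) (?S ` X) \<le> t}"
    using X by (simp add: offset_def gsetdist_eq_infdist)
  define T where "T = {z. infdist z (?S ` X) \<le> t}"
  have conts: "continuous_on A (scale_matrix c)" for A c
    by (intro linear_continuous_on linear_linear[THEN iffD2] linear_scale_matrix)
  have N: "compact (?S ` M)" "?S ` M \<noteq> {}" "?S ` X \<noteq> {}"
    using M X conts compact_continuous_image by auto
  have d: "infdist z (?S ` M) \<le> e" if "z \<in> ?S ` X" for z
    using that le e M by (auto simp: gsetdist_eq_infdist)
  have d': "infdist z (?S ` X) \<le> e" if "z \<in> ?S ` M" for z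
    using that le' e X by (auto simp: gsetdist_eq_infdist)
  note retr = offset_retraction[OF N(1,2,3) r(2) d d' e(2) te r(1), folded T_def]
  \<comment> \<open>The nearest-point projection for the weighted norm, as a conjugate of the
    Euclidean one. Scaling is linear, so it also carries segments to segments.\<close>
  define \<pi> where "\<pi> = (\<lambda>z. ?S' (closest_point (?S ` M) (?S z)))"
  have cont: "continuous_on (offset \<gamma> X t) \<pi>"
    unfolding \<pi>_def
    by (intro continuous_on_compose2[OF conts[of UNIV]] continuous_on_compose2[OF retr(1) conts])
       (auto simp: offset T_def)
  have S\<pi>: "?S (\<pi> z) = closest_point (?S ` M) (?S z)" for z
    by (simp add: \<pi>_def scale_matrix_inverse \<gamma>)
  have range: "\<pi> z \<in> M" for z
  proof -
    have "?S (\<pi> z) \<in> ?S ` M"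
      unfolding S\<pi> using N by (intro closest_point_in_set compact_imp_closed)
    then show ?thesis by (auto simp: scale_matrix_eq_iff[OF \<gamma>])
  qed
  have fix_M: "\<pi> z = z" if "z \<in> M" for z
    using that by (simp add: \<pi>_def closest_point_self scale_matrix_inverse \<gamma>)
  have seg: "closed_segment z (\<pi> z) \<subseteq> offset \<gamma> X t" if "z \<in> offset \<gamma> X t" for z
  proof -
    have "?S ` closed_segment z (\<pi> z) = closed_segment (?S z) (closest_point (?S ` M) (?S z))"
      by (simp add: S\<pi> flip: closed_segment_linear_image[OF linear_scale_matrix])
    moreover have "infdist (?S z) (?S ` X) \<le> t"
      using that by (simp add: offset)
    ultimately have "?S ` closed_segment z (\<pi> z) \<subseteq> T"
      using retr(3) by presburger
    then show ?thesis
      unfolding offset T_def by blast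
  qed
  have "homotopic_with_canon (\<lambda>_. True) (offset \<gamma> X t) (offset \<gamma> X t) \<pi> id"
  proof (rule homotopic_with_linear)
    fix z assume "z \<in> offset \<gamma> X t"
    then show "closed_segment (\<pi> z) (id z) \<subseteq> offset \<gamma> X t"
      unfolding id_apply closed_segment_commute[of "\<pi> z"] by (rule seg)
  qed (use cont in auto)
  moreover have "M \<subseteq> offset \<gamma> X t"
    using retr(2) unfolding offset T_def by blast
  moreover have "continuous_map (top_of_set (offset \<gamma> X t)) (top_of_set M) \<pi>"
    using cont range by (simp add: continuous_map_in_subtopology image_subset_iff)
  ultimately show thesis
    using that fix_M by blast
qed

section \<open>The isomorphism induced by \<open>u_check\<close> and its effect on characteristic
  classes\<close>

theorem corollary3p7:
  fixes M0 :: "'a topology" and \<A> :: "'a atlas" and k d :: nat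
    and u :: "'a \<Rightarrow> real^'n" and p :: "'a \<Rightarrow> real^'m^'m"
    and \<gamma> t :: real and X :: "((real^'n) \<times> (real^'m^'m)) set"
    and u_check :: "'a \<Rightarrow> (real^'n) \<times> (real^'m^'m)"
    and M_check :: "((real^'n) \<times> (real^'m^'m)) set" and \<epsilon> :: ereal
  assumes d: "1 \<le> d" "d \<le> CARD('m) - 1"
    and M0: "Cr_manifold 3 k M0 \<A>" "compact_space M0" "topspace M0 \<noteq> {}"
    and u: "Cr_immersion 3 k \<A> u"
    and p: "continuous_map M0 (top_of_set (grassmannian d)) p"
    and \<gamma>: "\<gamma> > 0"
    and u_check: "u_check = (\<lambda>x. (u x, p x))"
    and M_check: "M_check = u_check ` topspace M0"
    and embedding: "embedding_map M0 euclidean u_check"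
    and X: "X \<noteq> {}"
    and \<epsilon>: "\<epsilon> = hausdorff_distance \<gamma> X M_check"
    and \<epsilon>_le: "\<epsilon> \<le> reach \<gamma> M_check / 17"
    and t: "4 * \<epsilon> \<le> ereal t" "ereal t < reach \<gamma> M_check - 3 * \<epsilon>" "t < t_max \<gamma> d X"
  shows "continuous_map M0 (top_of_set (offset \<gamma> X t)) u_check \<and>
    (\<forall>j. cohomology_pullback j M0 u_check
           \<in> iso (cohomology_group j (top_of_set (offset \<gamma> X t))) (cohomology_group j M0)) \<and>
    (\<forall>i\<in>{1..d}. cohomology_pullback i M0 u_check (persistent_stiefel_whitney \<gamma> d X i t)
           = cohomology_pullback i M0 p (stiefel_whitney d i))"
proof -
  let ?T = "top_of_set (offset \<gamma> X t)"
  have homeo: "homeomorphic_map M0 (top_of_set M_check) u_check"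
    using embedding by (simp add: embedding_map_def M_check)
  then obtain g where g: "homeomorphic_maps M0 (top_of_set M_check) u_check g"
    using homeomorphic_map_maps by blast
  have cont_u: "continuous_map M0 (top_of_set M_check) u_check"
    using g homeomorphic_maps_def by blast
  have "compactin (top_of_set M_check) (u_check ` topspace M0)"
    using cont_u M0(2) by (intro image_compactin) (auto simp: compact_space_def)
  then have "compact M_check"
    by (simp add: compactin_subtopology flip: M_check)
  moreover have "M_check \<noteq> {}"
    using M0(3) by (simp add: M_check)
  ultimately obtain \<pi> where \<pi>: "continuous_map ?T (top_of_set M_check) \<pi>"
    and sub: "M_check \<subseteq> offset \<gamma> X t" and fix_M: "\<And>x. x \<in> M_check \<Longrightarrow> \<pi> x = x"
    and hom: "homotopic_with (\<lambda>_. True) ?T ?T \<pi> id"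
    using offset_homotopy_equivalence[OF \<gamma> _ _ X t(1,2)[unfolded \<epsilon>]] by metis
  have f: "continuous_map M0 ?T u_check"
    using cont_u sub by (auto simp: continuous_map_in_subtopology)
  \<comment> \<open>The homotopy inverse of \<open>u_check\<close>: retract to
    \<open>M_check\<close>, then undo the embedding.\<close>
  have gc: "continuous_map ?T M0 (g \<circ> \<pi>)"
    using \<pi> g continuous_map_compose unfolding homeomorphic_maps_def by blast
  have gu: "g (u_check x) = x" if "x \<in> topspace M0" for x
    using g that by (simp add: homeomorphic_maps_def)
  have ug: "u_check (g y) = y" if "y \<in> M_check" for y
    using g that by (simp add: homeomorphic_maps_def)
  have "homotopic_with (\<lambda>_. True) M0 M0 (g \<circ> \<pi> \<circ> u_check) id"
    using gu fix_M continuous_map_compose[OF f gc]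
    by (intro homotopic_with_equal) (auto simp: M_check)
  moreover have "homotopic_with (\<lambda>_. True) ?T ?T (u_check \<circ> (g \<circ> \<pi>)) id"
  proof (rule homotopic_with_trans[OF _ hom])
    have "\<pi> x \<in> M_check" if "x \<in> offset \<gamma> X t" for x
      using \<pi> that by (auto simp: continuous_map_def)
    then show "homotopic_with (\<lambda>_. True) ?T ?T (u_check \<circ> (g \<circ> \<pi>)) \<pi>"
      using ug continuous_map_compose[OF gc f] by (intro homotopic_with_equal) auto
  qed
  ultimately have "\<forall>j. cohomology_pullback j M0 u_check
      \<in> iso (cohomology_group j ?T) (cohomology_group j M0)"
    using cohomology_pullback_homotopy_equivalence[OF f gc] by blast
  moreover have "cohomology_pullback i M0 u_check (persistent_stiefel_whitney \<gamma> d X i t)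
      = cohomology_pullback i M0 p (stiefel_whitney d i)" for i
  proof -
    \<comment> \<open>\<open>p x\<close> already lies in the Grassmannian, so it is its own nearest
      point there.\<close>
    have "cech_projection d (u_check x) = p x" if "x \<in> topspace M0" for x
      using continuous_map_image_subset_topspace[OF p] that
      by (auto simp: cech_projection_def u_check intro: closest_point_self)
    then show ?thesis
      unfolding persistent_stiefel_whitney_def cohomology_pullback_compose[OF f]
      by (intro cohomology_pullback_cong) simp
  qed
  ultimately show ?thesis using f by blast
qed

end
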